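(* Let $(W,S)$ be an irreducible Coxeter system of finite rank with simply laced Coxeter graph $G$. Suppose the rank of $\mathrm{H}_1(G)$ is $0$ or $1$. Then any nontrivial irreducible A1-representation of $W$ is an R-representation. In particular, such representations are finite dimensional. If $\mathrm{H}_1(G)$ has rank $0$, such a representation is unique (up to isomorphism).
   Context: $W=\langle S\mid s^2=(st)^{m_{st}}=e,\ \forall s\ne t\in S\rangle$, $S$ finite. Simply laced means $m_{st}\in\{2,3\}$ for all $s\ne t\in S$. The Coxeter graph $G$ has vertex set $S$, with an edge $\{s,t\}$ iff $m_{st}\ge3$; irreducible means $G$ is connected. $\mathrm{H}_1(G)$ is the first integral homology group of $G$ viewed as a 1-dimensional simplicial complex (labels ignored); it is free abelian of finite rank. All representations are complex, possibly infinite dimensional. A1-representation: a representation $V$ of $W$ such that there is no $v\in V\setminus\{0\}$ with $r\cdot v=t\cdot v=-v$ for some $r\ne t\in S$ with $m_{rt}<\infty$. R-representation: a representation $V$ of $W$ spanned by nonzero vectors $\{\alpha_s\mid s\in S\}$ such that for every $s\in S$ there is a subspace $H_s$ of codimension $1$ with $s|_{H_s}=\mathrm{Id}_{H_s}$ and $s\cdot\alpha_s=-\alpha_s$, and moreover for all $r\neq t\in S$ with $m_{rt}<\infty$ the vectors $\alpha_r,\alpha_t$ are linearly independent. *)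

theory Defs
  imports
    Complex_Main
    "HOL-Library.Extended_Nat"
    "HOL-Algebra.Group_Action"
    "HOL-Algebra.Free_Abelian_Groups"
begin

section \<open>Groups given by generators and relators\<close>

text \<open>
  Words are lists of signed letters: \<open>(s, True)\<close> stands for the generator \<open>s\<close>
  and \<open>(s, False)\<close> for its formal inverse. The group \<open>\<langle>S | R\<rangle>\<close> consists of
  the classes of words modulo the congruence generated by free cancellation and
  by deletion of relators.
\<close>

type_synonym 'a word = "('a \<times> bool) list"

definition words :: "'a set \<Rightarrow> 'a word set" where
  "words S = lists (S \<times> UNIV)"

inductive_set presentation_rel :: "'a set \<Rightarrow> 'a word set \<Rightarrow> ('a word \<times> 'a word) set"
  for S R where
  refl: "w \<in> words S \<Longrightarrow> (w, w) \<in> presentation_rel S R"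
| sym: "(v, w) \<in> presentation_rel S R \<Longrightarrow> (w, v) \<in> presentation_rel S R"
| trans: "(u, v) \<in> presentation_rel S R \<Longrightarrow> (v, w) \<in> presentation_rel S R
    \<Longrightarrow> (u, w) \<in> presentation_rel S R"
| cancel: "u \<in> words S \<Longrightarrow> v \<in> words S \<Longrightarrow> s \<in> S
    \<Longrightarrow> (u @ [(s, b), (s, \<not> b)] @ v, u @ v) \<in> presentation_rel S R"
| relator: "u \<in> words S \<Longrightarrow> v \<in> words S \<Longrightarrow> r \<in> R \<Longrightarrow> r \<in> words S
    \<Longrightarrow> (u @ r @ v, u @ v) \<in> presentation_rel S R"

definition presented_group :: "'a set \<Rightarrow> 'a word set \<Rightarrow> 'a word set monoid" where
  "presented_group S R =
    \<lparr>carrier = words S // presentation_rel S R,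
     monoid.mult = (\<lambda>A B. \<Union>x\<in>A. \<Union>y\<in>B. presentation_rel S R `` {x @ y}),
     one = presentation_rel S R `` {[]}\<rparr>"

lemma words_append [simp]: "u @ v \<in> words S \<longleftrightarrow> u \<in> words S \<and> v \<in> words S"
  by (auto simp: words_def)

lemma words_Nil [simp]: "[] \<in> words S"
  by (simp add: words_def)

lemma presentation_rel_words:
  "(v, w) \<in> presentation_rel S R \<Longrightarrow> v \<in> words S \<and> w \<in> words S"
  by (induction rule: presentation_rel.induct) (auto simp: words_def)

lemma equiv_presentation_rel: "equiv (words S) (presentation_rel S R)"
proof (rule equivI)
  show "presentation_rel S R \<subseteq> words S \<times> words S"
    using presentation_rel_words by fast
  show "refl_on (words S) (presentation_rel S R)"
    by (rule refl_onI) (rule presentation_rel.refl)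
  show "sym (presentation_rel S R)"
    by (rule symI) (rule presentation_rel.sym)
  show "trans (presentation_rel S R)"
    by (rule transI) (rule presentation_rel.trans)
qed

lemma presentation_rel_append_left:
  assumes "(v, w) \<in> presentation_rel S R" and "u \<in> words S"
  shows "(u @ v, u @ w) \<in> presentation_rel S R"
  using assms
proof (induction rule: presentation_rel.induct)
  case (refl w)
  then show ?case by (simp add: presentation_rel.refl)
next
  case (sym v w)
  then show ?case by (simp add: presentation_rel.sym)
next
  case (trans v w x)
  from trans.IH(1)[OF trans.prems] trans.IH(2)[OF trans.prems] show ?case
    by (rule presentation_rel.trans)
next
  case (cancel x y s b)
  then show ?case
    using presentation_rel.cancel[of "u @ x" S y s b R] by simp
next
  case (relator x y r)
  then show ?case
    using presentation_rel.relator[of "u @ x" S y r R] by simp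
qed

lemma presentation_rel_append_right:
  assumes "(v, w) \<in> presentation_rel S R" and "u \<in> words S"
  shows "(v @ u, w @ u) \<in> presentation_rel S R"
  using assms
proof (induction rule: presentation_rel.induct)
  case (refl w)
  then show ?case by (simp add: presentation_rel.refl)
next
  case (sym v w)
  then show ?case by (simp add: presentation_rel.sym)
next
  case (trans v w x)
  from trans.IH(1)[OF trans.prems] trans.IH(2)[OF trans.prems] show ?case
    by (rule presentation_rel.trans)
next
  case (cancel x y s b)
  then show ?case
    using presentation_rel.cancel[of x S "y @ u" s b R] by simp
next
  case (relator x y r)
  then show ?case
    using presentation_rel.relator[of x S "y @ u" r R] by simp
qed

lemma presentation_rel_append:
  assumes "(v, w) \<in> presentation_rel S R" and "(v', w') \<in> presentation_rel S R"
  shows "(v @ v', w @ w') \<in> presentation_rel S R"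
proof (rule presentation_rel.trans)
  show "(v @ v', w @ v') \<in> presentation_rel S R"
    using assms presentation_rel_words by (intro presentation_rel_append_right) blast+
  show "(w @ v', w @ w') \<in> presentation_rel S R"
    using assms presentation_rel_words by (intro presentation_rel_append_left) blast+
qed

lemma mult_presented_group:
  assumes "v \<in> words S" and "w \<in> words S"
  shows "presentation_rel S R `` {v} \<otimes>\<^bsub>presented_group S R\<^esub> presentation_rel S R `` {w}
    = presentation_rel S R `` {v @ w}"
proof -
  let ?r = "presentation_rel S R"
  have eq: "?r `` {x @ y} = ?r `` {v @ w}" if "x \<in> ?r `` {v}" "y \<in> ?r `` {w}" for x y
  proof -
    have "(v @ w, x @ y) \<in> ?r"
      using that by (simp add: presentation_rel_append)
    then show ?thesis
      by (rule equiv_class_eq[OF equiv_presentation_rel, symmetric])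
  qed
  have mem: "v \<in> ?r `` {v}" "w \<in> ?r `` {w}"
    using assms by (simp_all add: presentation_rel.refl)
  have "(\<Union>x\<in>?r `` {v}. \<Union>y\<in>?r `` {w}. ?r `` {x @ y})
      = (\<Union>x\<in>?r `` {v}. \<Union>y\<in>?r `` {w}. ?r `` {v @ w})"
    using eq by simp
  also have "\<dots> = ?r `` {v @ w}"
    using mem by blast
  finally show ?thesis
    by (simp only: presented_group_def monoid.simps)
qed

lemma presentation_rel_inverse:
  assumes "w \<in> words S"
  shows "(rev (map (\<lambda>(s, b). (s, \<not> b)) w) @ w, []) \<in> presentation_rel S R"
  using assms
proof (induction w)
  case Nil
  then show ?case by (simp add: presentation_rel.refl)
next
  case (Cons a w)
  obtain s b where a: "a = (s, b)" by force
  let ?i = "rev (map (\<lambda>(s, b). (s, \<not> b)) w)"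
  have s: "s \<in> S" and w: "w \<in> words S" and i: "?i \<in> words S"
    using Cons.prems by (auto simp: a words_def in_lists_conv_set)
  have "(?i @ [(s, \<not> b), (s, \<not> \<not> b)] @ w, ?i @ w) \<in> presentation_rel S R"
    by (rule presentation_rel.cancel[OF i w s])
  then have "(?i @ [(s, \<not> b), (s, b)] @ w, []) \<in> presentation_rel S R"
    using presentation_rel.trans[OF _ Cons.IH[OF w]] by simp
  then show ?case by (simp add: a)
qed

lemma group_presented_group: "group (presented_group S R)"
proof (rule groupI)
  let ?r = "presentation_rel S R" and ?G = "presented_group S R"
  have car: "\<exists>w\<in>words S. A = ?r `` {w}" if "A \<in> carrier ?G" for A
    using that by (auto simp: presented_group_def elim!: quotientE)
  have in_car: "?r `` {w} \<in> carrier ?G" if "w \<in> words S" for w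
    using that by (auto simp: presented_group_def intro: quotientI)
  have one: "\<one>\<^bsub>?G\<^esub> = ?r `` {[]}"
    by (simp add: presented_group_def)
  show "\<one>\<^bsub>?G\<^esub> \<in> carrier ?G"
    by (simp add: one in_car)
  fix A assume "A \<in> carrier ?G"
  then obtain u where u: "u \<in> words S" "A = ?r `` {u}" using car by blast
  show "\<one>\<^bsub>?G\<^esub> \<otimes>\<^bsub>?G\<^esub> A = A"
    using u by (simp add: one mult_presented_group)
  let ?i = "rev (map (\<lambda>(s, b). (s, \<not> b)) u)"
  have i: "?i \<in> words S"
    using u(1) by (auto simp: words_def in_lists_conv_set)
  have "?r `` {?i} \<otimes>\<^bsub>?G\<^esub> A = \<one>\<^bsub>?G\<^esub>"
    using u i presentation_rel_inverse[OF u(1), of R]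
    by (simp add: one mult_presented_group equiv_class_eq[OF equiv_presentation_rel])
  then show "\<exists>B\<in>carrier ?G. B \<otimes>\<^bsub>?G\<^esub> A = \<one>\<^bsub>?G\<^esub>"
    using in_car[OF i] by blast
  fix B assume "B \<in> carrier ?G"
  then obtain v where v: "v \<in> words S" "B = ?r `` {v}" using car by blast
  show "A \<otimes>\<^bsub>?G\<^esub> B \<in> carrier ?G"
    using u v by (simp add: mult_presented_group in_car)
  fix C assume "C \<in> carrier ?G"
  then obtain w where w: "w \<in> words S" "C = ?r `` {w}" using car by blast
  show "A \<otimes>\<^bsub>?G\<^esub> B \<otimes>\<^bsub>?G\<^esub> C = A \<otimes>\<^bsub>?G\<^esub> (B \<otimes>\<^bsub>?G\<^esub> C)"
    using u v w by (simp add: mult_presented_group)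
qed


section \<open>Coxeter systems of finite rank and their graphs\<close>

text \<open>
  A Coxeter system is given by its generating set and its labels
  \<open>m s t \<in> {2, 3, \<dots>, \<infinity>}\<close>. Diagonal labels are never used; the relators
  \<open>s\<^sup>2\<close> are imposed separately.
\<close>

definition coxeter_system :: "'s set \<Rightarrow> ('s \<Rightarrow> 's \<Rightarrow> enat) \<Rightarrow> bool" where
  "coxeter_system S m \<longleftrightarrow> finite S \<and>
    (\<forall>s\<in>S. \<forall>t\<in>S. s \<noteq> t \<longrightarrow> m s t = m t s \<and> 2 \<le> m s t)"

definition coxeter_relators :: "'s set \<Rightarrow> ('s \<Rightarrow> 's \<Rightarrow> enat) \<Rightarrow> 's word set" where
  "coxeter_relators S m =
    {[(s, True), (s, True)] | s. s \<in> S} \<union>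
    {concat (replicate k [(s, True), (t, True)]) | s t k.
      s \<in> S \<and> t \<in> S \<and> s \<noteq> t \<and> m s t = enat k}"

definition coxeter_group :: "'s set \<Rightarrow> ('s \<Rightarrow> 's \<Rightarrow> enat) \<Rightarrow> 's word set monoid" where
  "coxeter_group S m = presented_group S (coxeter_relators S m)"

definition coxeter_gen :: "'s set \<Rightarrow> ('s \<Rightarrow> 's \<Rightarrow> enat) \<Rightarrow> 's \<Rightarrow> 's word set" where
  "coxeter_gen S m s = presentation_rel S (coxeter_relators S m) `` {[(s, True)]}"

definition simply_laced :: "'s set \<Rightarrow> ('s \<Rightarrow> 's \<Rightarrow> enat) \<Rightarrow> bool" where
  "simply_laced S m \<longleftrightarrow> (\<forall>s\<in>S. \<forall>t\<in>S. s \<noteq> t \<longrightarrow> m s t \<in> {2, 3})"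

definition coxeter_edges :: "'s set \<Rightarrow> ('s \<Rightarrow> 's \<Rightarrow> enat) \<Rightarrow> ('s \<times> 's) set" where
  "coxeter_edges S m = {(s, t). s \<in> S \<and> t \<in> S \<and> s \<noteq> t \<and> 3 \<le> m s t}"

text \<open>The empty graph is not regarded as connected.\<close>

definition connected_graph :: "'s set \<Rightarrow> ('s \<times> 's) set \<Rightarrow> bool" where
  "connected_graph S E \<longleftrightarrow> S \<noteq> {} \<and> (\<forall>s\<in>S. \<forall>t\<in>S. (s, t) \<in> E\<^sup>*)"

definition irreducible_coxeter_system :: "'s set \<Rightarrow> ('s \<Rightarrow> 's \<Rightarrow> enat) \<Rightarrow> bool" where
  "irreducible_coxeter_system S m \<longleftrightarrow>
    coxeter_system S m \<and> connected_graph S (coxeter_edges S m)"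


section \<open>First homology of a graph\<close>

text \<open>
  A graph is given by its (symmetric, irreflexive) set \<open>E\<close> of ordered edges.
  The oriented simplicial \<open>1\<close>-chains, in which \<open>[t, s] = - [s, t]\<close>, are realised as
  the antisymmetric elements of the free abelian group on \<open>E\<close>: the oriented simplex
  \<open>[s, t]\<close> is \<open>frag_of (s, t) - frag_of (t, s)\<close>. The linear extension of
  \<open>(s, t) \<mapsto> t\<close> then maps \<open>[s, t]\<close> to \<open>t - s\<close>, so it is the usual boundary map.
  As there are no \<open>2\<close>-simplices, \<open>H\<^sub>1\<close> is the kernel of the boundary map.
\<close>

definition graph_chains1 :: "('s \<times> 's) set \<Rightarrow> (('s \<times> 's) \<Rightarrow>\<^sub>0 int) monoid" where
  "graph_chains1 E = (free_Abelian_group E)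
    \<lparr>carrier := {c \<in> carrier (free_Abelian_group E).
      \<forall>s t. Poly_Mapping.lookup c (t, s) = - Poly_Mapping.lookup c (s, t)}\<rparr>"

definition graph_boundary1 :: "(('s \<times> 's) \<Rightarrow>\<^sub>0 int) \<Rightarrow> ('s \<Rightarrow>\<^sub>0 int)" where
  "graph_boundary1 = frag_extend (\<lambda>(s, t). frag_of t)"

definition graph_H1 :: "'s set \<Rightarrow> ('s \<times> 's) set \<Rightarrow> (('s \<times> 's) \<Rightarrow>\<^sub>0 int) monoid" where
  "graph_H1 S E = (graph_chains1 E)
    \<lparr>carrier := kernel (graph_chains1 E) (free_Abelian_group S) graph_boundary1\<rparr>"

lemma graph_boundary1_edge:
  "graph_boundary1 (frag_of (s, t) - frag_of (t, s)) = frag_of t - frag_of s"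
  by (simp add: graph_boundary1_def frag_extend_diff)

definition free_abelian_of_rank :: "('a, 'b) monoid_scheme \<Rightarrow> nat \<Rightarrow> bool" where
  "free_abelian_of_rank H r \<longleftrightarrow> H \<cong> free_Abelian_group {..<r}"


section \<open>Linear representations\<close>

text \<open>
  The representation space is a subspace \<open>V\<close> of an ambient complex vector space,
  with no restriction on dimensions.
\<close>

locale linear_rep = vector_space scale + group_action G V \<rho>
  for scale :: "complex \<Rightarrow> 'v::ab_group_add \<Rightarrow> 'v" (infixr \<open>*s\<close> 75)
    and G :: "('g, 'b) monoid_scheme" (structure)
    and V :: "'v set"
    and \<rho> :: "'g \<Rightarrow> 'v \<Rightarrow> 'v" +
  assumes subspace_V: "subspace V"
    and rep_add: "g \<in> carrier G \<Longrightarrow> u \<in> V \<Longrightarrow> v \<in> V \<Longrightarrow> \<rho> g (u + v) = \<rho> g u + \<rho> g v"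
    and rep_scale: "g \<in> carrier G \<Longrightarrow> v \<in> V \<Longrightarrow> \<rho> g (c *s v) = c *s \<rho> g v"

definition irreducible_rep :: "(complex \<Rightarrow> 'v \<Rightarrow> 'v) \<Rightarrow> ('g, 'b) monoid_scheme
    \<Rightarrow> 'v::ab_group_add set \<Rightarrow> ('g \<Rightarrow> 'v \<Rightarrow> 'v) \<Rightarrow> bool" where
  "irreducible_rep scale G V \<rho> \<longleftrightarrow> linear_rep scale G V \<rho> \<and> V \<noteq> {0} \<and>
    (\<forall>U. module.subspace scale U \<and> U \<subseteq> V \<and> (\<forall>g\<in>carrier G. \<forall>u\<in>U. \<rho> g u \<in> U)
      \<longrightarrow> U = {0} \<or> U = V)"

definition nontrivial_rep :: "('g, 'b) monoid_scheme \<Rightarrow> 'v set \<Rightarrow> ('g \<Rightarrow> 'v \<Rightarrow> 'v) \<Rightarrow> bool" where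
  "nontrivial_rep G V \<rho> \<longleftrightarrow> (\<exists>g\<in>carrier G. \<exists>v\<in>V. \<rho> g v \<noteq> v)"

definition isomorphic_reps ::
  "('g, 'b) monoid_scheme
    \<Rightarrow> (complex \<Rightarrow> 'v \<Rightarrow> 'v) \<Rightarrow> 'v::ab_group_add set \<Rightarrow> ('g \<Rightarrow> 'v \<Rightarrow> 'v)
    \<Rightarrow> (complex \<Rightarrow> 'w \<Rightarrow> 'w) \<Rightarrow> 'w::ab_group_add set \<Rightarrow> ('g \<Rightarrow> 'w \<Rightarrow> 'w) \<Rightarrow> bool" where
  "isomorphic_reps G scale V \<rho> scale' V' \<rho>' \<longleftrightarrow> (\<exists>f. bij_betw f V V' \<and>
    (\<forall>u\<in>V. \<forall>v\<in>V. f (u + v) = f u + f v) \<and>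
    (\<forall>c. \<forall>v\<in>V. f (scale c v) = scale' c (f v)) \<and>
    (\<forall>g\<in>carrier G. \<forall>v\<in>V. f (\<rho> g v) = \<rho>' g (f v)))"

definition finite_dim :: "(complex \<Rightarrow> 'v \<Rightarrow> 'v) \<Rightarrow> 'v::ab_group_add set \<Rightarrow> bool" where
  "finite_dim scale V \<longleftrightarrow> (\<exists>B. finite B \<and> module.span scale B = V)"

definition codim1_subspace ::
  "(complex \<Rightarrow> 'v \<Rightarrow> 'v) \<Rightarrow> 'v::ab_group_add set \<Rightarrow> 'v set \<Rightarrow> bool" where
  "codim1_subspace scale V H \<longleftrightarrow> module.subspace scale H \<and> H \<subseteq> V \<and>
    (\<exists>u\<in>V - H. module.span scale (insert u H) = V)"


section \<open>A1- and R-representations of Coxeter groups\<close>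

definition A1_representation :: "(complex \<Rightarrow> 'v \<Rightarrow> 'v) \<Rightarrow> 's set \<Rightarrow> ('s \<Rightarrow> 's \<Rightarrow> enat)
    \<Rightarrow> 'v::ab_group_add set \<Rightarrow> ('s word set \<Rightarrow> 'v \<Rightarrow> 'v) \<Rightarrow> bool" where
  "A1_representation scale S m V \<rho> \<longleftrightarrow> linear_rep scale (coxeter_group S m) V \<rho> \<and>
    \<not> (\<exists>v\<in>V - {0}. \<exists>r\<in>S. \<exists>t\<in>S. r \<noteq> t \<and> m r t < \<infinity> \<and>
        \<rho> (coxeter_gen S m r) v = - v \<and> \<rho> (coxeter_gen S m t) v = - v)"

definition R_representation :: "(complex \<Rightarrow> 'v \<Rightarrow> 'v) \<Rightarrow> 's set \<Rightarrow> ('s \<Rightarrow> 's \<Rightarrow> enat)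
    \<Rightarrow> 'v::ab_group_add set \<Rightarrow> ('s word set \<Rightarrow> 'v \<Rightarrow> 'v) \<Rightarrow> bool" where
  "R_representation scale S m V \<rho> \<longleftrightarrow> linear_rep scale (coxeter_group S m) V \<rho> \<and>
    (\<exists>\<alpha>. (\<forall>s\<in>S. \<alpha> s \<in> V \<and> \<alpha> s \<noteq> 0) \<and> module.span scale (\<alpha> ` S) = V \<and>
      (\<forall>s\<in>S. (\<exists>H. codim1_subspace scale V H \<and> (\<forall>v\<in>H. \<rho> (coxeter_gen S m s) v = v)) \<and>
        \<rho> (coxeter_gen S m s) (\<alpha> s) = - \<alpha> s) \<and>
      (\<forall>r\<in>S. \<forall>t\<in>S. r \<noteq> t \<and> m r t < \<infinity> \<longrightarrow>
        \<alpha> r \<noteq> \<alpha> t \<and> \<not> module.dependent scale {\<alpha> r, \<alpha> t}))"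

end

(*
  In an A1-representation the (-1)-eigenspaces U_s satisfy U_r \<inter> U_t = 0. Hence v \<mapsto> t v - v kills
  U_s if s and t commute, and it is an isomorphism U_s \<rightarrow> U_t with inverse w \<mapsto> s w - w if m_st = 3.
  Along a spanning tree all U_s are thus identified with one space U, and each edge off the tree
  gives a monodromy operator on U; there are at most rank H_1 such edges. With at most one monodromy
  operator F, irreducibility of V makes U an irreducible C[F, 1/F]-module, so F has an eigenvector
  even if V is not assumed finite dimensional. Transporting it along the tree yields the root
  vectors. Without monodromy, the action on the root vectors is that of the geometric
  representation, and the relations among them must form the whole radical of its bilinear form.
*)
theory Submission
  imports Defs "HOL-Computational_Algebra.Fundamental_Theorem_Algebra"
begin

section \<open>Coxeter groups and their generators\<close>

text \<open>All maps between the eigenspaces are instances of \<open>refl_diff s\<close>, that is s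
  - 1, which is -2 times the projection onto U_s. It sends all of V into U_s, and with this
  normalisation the two maps of an edge are inverse to each other without any scalar. Its scalars -2
  on U_s itself, 1 between root vectors matched along an edge and 0 for commuting pairs are the
  negated entries of the Cartan matrix.

  One monodromy operator is the limit of the method: irreducible modules over the commutative ring
  C[F, 1/F] are one-dimensional, whereas two independent operators would give modules over a free
  group algebra, which can be irreducible of infinite dimension. The eigenvalue of F is an
  isomorphism invariant, so uniqueness is a matter of trees.

  The relations fill the radical because a combination of root vectors lying in it is fixed by W,
  and an irreducible nontrivial V has no fixed vector except 0. Two such representations over one
  tree thus obey the same relations.\<close>

definition cox_class :: "'s set \<Rightarrow> ('s \<Rightarrow> 's \<Rightarrow> enat) \<Rightarrow> 's word \<Rightarrow> 's word set" where
  "cox_class S m w = presentation_rel S (coxeter_relators S m) `` {w}"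

lemma group_coxeter_group: "group (coxeter_group S m)"
  by (simp add: coxeter_group_def group_presented_group)

lemma cox_class_in_carrier: "w \<in> words S \<Longrightarrow> cox_class S m w \<in> carrier (coxeter_group S m)"
  by (auto simp: cox_class_def coxeter_group_def presented_group_def intro: quotientI)

lemma coxeter_gen_eq: "coxeter_gen S m s = cox_class S m [(s, True)]"
  by (simp add: cox_class_def coxeter_gen_def)

lemma cox_class_mult:
  "v \<in> words S \<Longrightarrow> w \<in> words S \<Longrightarrow>
    cox_class S m v \<otimes>\<^bsub>coxeter_group S m\<^esub> cox_class S m w = cox_class S m (v @ w)"
  by (simp add: cox_class_def coxeter_group_def mult_presented_group)

lemma one_coxeter_group: "\<one>\<^bsub>coxeter_group S m\<^esub> = cox_class S m []"
  by (simp add: cox_class_def coxeter_group_def presented_group_def)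

lemma cox_class_eq_iff:
  "v \<in> words S \<Longrightarrow> w \<in> words S \<Longrightarrow>
    cox_class S m v = cox_class S m w \<longleftrightarrow> (v, w) \<in> presentation_rel S (coxeter_relators S m)"
  unfolding cox_class_def by (rule eq_equiv_class_iff[OF equiv_presentation_rel])

lemma carrier_coxeter_groupE:
  assumes "g \<in> carrier (coxeter_group S m)"
  obtains w where "w \<in> words S" "g = cox_class S m w"
  using assms by (auto simp: cox_class_def coxeter_group_def presented_group_def elim!: quotientE)

lemma coxeter_gen_closed:
  "s \<in> S \<Longrightarrow> coxeter_gen S m s \<in> carrier (coxeter_group S m)"
  by (auto simp: coxeter_gen_eq words_def intro!: cox_class_in_carrier)

lemma cox_relator_eq_one:
  "r \<in> coxeter_relators S m \<Longrightarrow> r \<in> words S \<Longrightarrow> cox_class S m r = \<one>\<^bsub>coxeter_group S m\<^esub>"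
  using presentation_rel.relator[of "[]" S "[]" r "coxeter_relators S m"]
  by (simp add: one_coxeter_group cox_class_eq_iff)

lemma coxeter_gen_square:
  assumes "s \<in> S"
  shows "coxeter_gen S m s \<otimes>\<^bsub>coxeter_group S m\<^esub> coxeter_gen S m s = \<one>\<^bsub>coxeter_group S m\<^esub>"
proof -
  have "[(s, True)] \<in> words S" "[(s, True), (s, True)] \<in> words S"
    using assms by (auto simp: words_def)
  moreover have "[(s, True), (s, True)] \<in> coxeter_relators S m"
    using assms by (auto simp: coxeter_relators_def)
  ultimately show ?thesis
    using cox_relator_eq_one[of "[(s, True), (s, True)]" S m] by (simp add: coxeter_gen_eq cox_class_mult)
qed

text \<open>The relators contain positive letters only, so formal inverses are absorbed here: each
  generator is its own inverse.\<close>

lemma cox_class_letter: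
  assumes "s \<in> S"
  shows "cox_class S m [(s, b)] = coxeter_gen S m s"
proof (cases b)
  case False
  interpret group "coxeter_group S m" by (rule group_coxeter_group)
  have w: "[(s, True)] \<in> words S" "[(s, False)] \<in> words S"
    using assms by (auto simp: words_def)
  have "([(s, False), (s, True)], []) \<in> presentation_rel S (coxeter_relators S m)"
    using presentation_rel.cancel[of "[]" S "[]" s False] assms by simp
  then have "cox_class S m [(s, False)] \<otimes>\<^bsub>coxeter_group S m\<^esub> coxeter_gen S m s = \<one>\<^bsub>coxeter_group S m\<^esub>"
    using w assms by (subst coxeter_gen_eq, subst cox_class_mult)
      (auto simp: one_coxeter_group cox_class_eq_iff words_def)
  moreover note coxeter_gen_square[OF assms, of m]
  ultimately show ?thesis
    using False right_cancel[of "coxeter_gen S m s" "cox_class S m [(s, False)]" "coxeter_gen S m s"]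
      coxeter_gen_closed[OF assms, of m] cox_class_in_carrier[OF w(2), of m] by simp
qed (simp add: coxeter_gen_eq)

text \<open>Replaces induction on signed words: left multiplication by generators reaches every
  element, so no case for inverses arises.\<close>

lemma coxeter_group_induct [consumes 1, case_names one gen]:
  assumes "g \<in> carrier (coxeter_group S m)"
    and "P \<one>\<^bsub>coxeter_group S m\<^esub>"
    and "\<And>s g. s \<in> S \<Longrightarrow> g \<in> carrier (coxeter_group S m) \<Longrightarrow> P g \<Longrightarrow>
      P (coxeter_gen S m s \<otimes>\<^bsub>coxeter_group S m\<^esub> g)"
  shows "P g"
proof -
  have "P (cox_class S m w)" if "w \<in> words S" for w
    using that
  proof (induction w)
    case Nil
    then show ?case using assms(2) by (simp add: one_coxeter_group)
  next
    case (Cons a w)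
    obtain s b where a: "a = (s, b)" by force
    have s: "s \<in> S" "[(s, b)] \<in> words S" and w: "w \<in> words S"
      using Cons.prems by (auto simp: a words_def)
    have "P (coxeter_gen S m s \<otimes>\<^bsub>coxeter_group S m\<^esub> cox_class S m w)"
      by (rule assms(3)[OF s(1) cox_class_in_carrier[OF w] Cons.IH[OF w]])
    then show ?case
      using cox_class_mult[OF s(2) w, of m] cox_class_letter[OF s(1), of m b] by (simp add: a)
  qed
  then show ?thesis
    using assms(1) by (auto elim: carrier_coxeter_groupE)
qed

lemma coxeter_gen_relation:
  assumes "s \<in> S" "t \<in> S" "s \<noteq> t" "m s t = enat k"
  shows "(coxeter_gen S m s \<otimes>\<^bsub>coxeter_group S m\<^esub> coxeter_gen S m t) [^]\<^bsub>coxeter_group S m\<^esub> k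
    = \<one>\<^bsub>coxeter_group S m\<^esub>"
proof -
  interpret group "coxeter_group S m" by (rule group_coxeter_group)
  let ?w = "[(s, True), (t, True)]"
  have w: "[(s, True)] \<in> words S" "[(t, True)] \<in> words S" "?w \<in> words S"
    using assms by (auto simp: words_def)
  have st: "coxeter_gen S m s \<otimes>\<^bsub>coxeter_group S m\<^esub> coxeter_gen S m t = cox_class S m ?w"
    using w by (simp add: coxeter_gen_eq cox_class_mult)
  have cw: "concat (replicate n ?w) \<in> words S" for n
    using assms by (induction n) (auto simp: words_def)
  have "cox_class S m ?w [^]\<^bsub>coxeter_group S m\<^esub> n = cox_class S m (concat (replicate n ?w))" for n
  proof (induction n)
    case (Suc n)
    have "cox_class S m ?w [^]\<^bsub>coxeter_group S m\<^esub> Suc n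
        = cox_class S m ?w \<otimes>\<^bsub>coxeter_group S m\<^esub> cox_class S m (concat (replicate n ?w))"
      unfolding Suc[symmetric] by (rule nat_pow_Suc2[OF cox_class_in_carrier[OF w(3)]])
    also have "\<dots> = cox_class S m (concat (replicate (Suc n) ?w))"
      by (simp only: cox_class_mult[OF w(3) cw]) simp
    finally show ?case .
  qed (simp add: one_coxeter_group)
  moreover have "concat (replicate k ?w) \<in> coxeter_relators S m"
    using assms by (auto simp: coxeter_relators_def)
  ultimately show ?thesis
    using cw by (simp add: st cox_relator_eq_one)
qed

text \<open>Signs of letters are ignored because the maps \<open>r s\<close> are meant to be
  involutions; free cancellation then becomes the square relation.\<close>

fun word_act :: "('s \<Rightarrow> 'v \<Rightarrow> 'v) \<Rightarrow> 's word \<Rightarrow> 'v \<Rightarrow> 'v" where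
  "word_act r [] x = x"
| "word_act r ((s, b) # w) x = r s (word_act r w x)"

lemma word_act_append: "word_act r (u @ v) x = word_act r u (word_act r v x)"
  by (induction r u x rule: word_act.induct) auto

text \<open>The universal property of the presentation. The hypotheses concern points of
  \<open>V\<close> only, so \<open>r\<close> may be given by formulas on a larger space.\<close>

lemma coxeter_action_exists:
  fixes r :: "'s \<Rightarrow> 'v \<Rightarrow> 'v"
  assumes closed: "\<And>s x. s \<in> S \<Longrightarrow> x \<in> V \<Longrightarrow> r s x \<in> V"
    and square: "\<And>s x. s \<in> S \<Longrightarrow> x \<in> V \<Longrightarrow> r s (r s x) = x"
    and relation: "\<And>s t k x. s \<in> S \<Longrightarrow> t \<in> S \<Longrightarrow> s \<noteq> t \<Longrightarrow> m s t = enat k \<Longrightarrow> x \<in> V \<Longrightarrow>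
      ((\<lambda>y. r s (r t y)) ^^ k) x = x"
  obtains \<rho> where "group_action (coxeter_group S m) V \<rho>"
    and "\<And>s x. s \<in> S \<Longrightarrow> x \<in> V \<Longrightarrow> \<rho> (coxeter_gen S m s) x = r s x"
proof -
  let ?G = "coxeter_group S m"
  interpret group ?G by (rule group_coxeter_group)
  have wV: "word_act r w x \<in> V" if "w \<in> words S" "x \<in> V" for w x
    using that by (induction w) (auto simp: words_def closed)
  have resp: "word_act r u x = word_act r v x"
    if "(u, v) \<in> presentation_rel S (coxeter_relators S m)" "x \<in> V" for u v x
    using that
  proof (induction arbitrary: x rule: presentation_rel.induct)
    case (cancel u v s b)
    then show ?case by (simp add: word_act_append wV square)
  next
    case (relator u v w)
    have rep: "word_act r (concat (replicate k [(s, True), (t, True)])) y = ((\<lambda>y. r s (r t y)) ^^ k) y"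
      for s t k y
      by (induction k) auto
    have "word_act r w y = y" if "y \<in> V" for y
      using relator.hyps that unfolding coxeter_relators_def by (auto simp: square rep relation)
    then show ?case
      using relator by (simp add: word_act_append wV)
  qed auto
  \<comment> \<open>Restricted to \<open>V\<close> because elements of \<open>BijGroup V\<close> are
    extensional; the choice of the word is harmless by \<open>resp\<close>.\<close>
  define \<rho> where "\<rho> g = (\<lambda>x\<in>V. word_act r (SOME w. w \<in> words S \<and> g = cox_class S m w) x)" for g
  have \<rho>: "\<rho> (cox_class S m w) x = word_act r w x" if "w \<in> words S" "x \<in> V" for w x
  proof -
    define w' where "w' = (SOME w'. w' \<in> words S \<and> cox_class S m w = cox_class S m w')"
    have "w' \<in> words S \<and> cox_class S m w = cox_class S m w'"
      unfolding w'_def by (rule someI[of _ w]) (use that in simp)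
    then have "word_act r w x = word_act r w' x"
      using that cox_class_eq_iff[of w S w' m] by (intro resp) auto
    then show ?thesis
      using that by (simp add: \<rho>_def w'_def)
  qed
  have ext: "\<rho> g \<in> extensional V" for g
    by (simp add: \<rho>_def)
  have \<rho>V: "\<rho> g x \<in> V" if "g \<in> carrier ?G" "x \<in> V" for g x
    using that by (elim carrier_coxeter_groupE) (simp add: \<rho> wV)
  have mult: "\<rho> (g \<otimes>\<^bsub>?G\<^esub> h) x = \<rho> g (\<rho> h x)"
    if "g \<in> carrier ?G" "h \<in> carrier ?G" "x \<in> V" for g h x
    using that by (elim carrier_coxeter_groupE) (simp add: \<rho> wV cox_class_mult word_act_append)
  have one: "\<rho> \<one>\<^bsub>?G\<^esub> x = x" if "x \<in> V" for x
    using that by (simp add: one_coxeter_group \<rho>)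
  have bij: "\<rho> g \<in> Bij V" if g: "g \<in> carrier ?G" for g
  proof -
    have "bij_betw (\<rho> g) V V"
      by (rule bij_betw_byWitness[where f' = "\<rho> (inv\<^bsub>?G\<^esub> g)"])
        (use g in \<open>auto simp: \<rho>V one mult[symmetric]\<close>)
    then show ?thesis by (simp add: Bij_def ext)
  qed
  have "\<rho> (g \<otimes>\<^bsub>?G\<^esub> h) = compose V (\<rho> g) (\<rho> h)" if "g \<in> carrier ?G" "h \<in> carrier ?G" for g h
    using that by (intro extensionalityI[OF ext compose_extensional]) (simp add: compose_eq mult)
  then have "\<rho> \<in> hom ?G (BijGroup V)"
    by (intro homI) (simp_all add: BijGroup_def bij)
  then have "group_hom ?G (BijGroup V) \<rho>"
    by (intro group_hom.intro group_hom_axioms.intro group_BijGroup is_group)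
  then have "group_action ?G V \<rho>"
    by (rule group_action.intro)
  moreover have "\<rho> (coxeter_gen S m s) x = r s x" if "s \<in> S" "x \<in> V" for s x
    using that \<rho>[of "[(s, True)]" x] by (simp add: coxeter_gen_eq words_def)
  ultimately show thesis by (rule that)
qed

section \<open>Linear maps on subspaces\<close>

definition linear_between ::
  "(complex \<Rightarrow> 'v::ab_group_add \<Rightarrow> 'v) \<Rightarrow> 'v set \<Rightarrow> 'v set \<Rightarrow> ('v \<Rightarrow> 'v) \<Rightarrow> bool" where
  "linear_between scale U U' F \<longleftrightarrow> (\<forall>x\<in>U. F x \<in> U') \<and>
    (\<forall>x\<in>U. \<forall>y\<in>U. F (x + y) = F x + F y) \<and> (\<forall>c. \<forall>x\<in>U. F (scale c x) = scale c (F x))"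

lemma linear_between_comp:
  "linear_between scale U U' F \<Longrightarrow> linear_between scale U' U'' F' \<Longrightarrow>
    linear_between scale U U'' (\<lambda>x. F' (F x))"
  by (simp add: linear_between_def)

section \<open>Polynomials in an endomorphism and the existence of eigenvectors\<close>

locale subspace_endomorphism = vector_space scale
  for scale :: "complex \<Rightarrow> 'v::ab_group_add \<Rightarrow> 'v" (infixr \<open>*s\<close> 75) +
  fixes U :: "'v set" and F :: "'v \<Rightarrow> 'v"
  assumes subspace_U: "subspace U"
    and linear_F: "linear_between (*s) U U F"
begin

lemma F_closed [simp]: "x \<in> U \<Longrightarrow> F x \<in> U"
  and F_add: "x \<in> U \<Longrightarrow> y \<in> U \<Longrightarrow> F (x + y) = F x + F y"
  and F_scale: "x \<in> U \<Longrightarrow> F (c *s x) = c *s F x"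
  using linear_F by (auto simp: linear_between_def)

lemma F_0: "F 0 = 0"
  using F_scale[of 0 0] subspace_0[OF subspace_U] by simp

text \<open>The vector p(F) x in Horner form, which suits induction over
  \<open>pCons\<close>.\<close>

definition poly_act :: "complex poly \<Rightarrow> 'v \<Rightarrow> 'v" where
  "poly_act p x = fold_coeffs (\<lambda>a g x. a *s x + F (g x)) p (\<lambda>x. 0) x"

lemma poly_act_0 [simp]: "poly_act 0 x = 0"
  by (simp add: poly_act_def)

lemma poly_act_pCons [simp]: "poly_act (pCons a p) x = a *s x + F (poly_act p x)"
  \<comment> \<open>\<open>pCons 0 0\<close> collapses to 0 and leaves no coefficient to fold, so
    that case rests on \<open>F_0\<close>.\<close>
  by (cases "p = 0 \<and> a = 0") (auto simp: poly_act_def F_0)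

lemma poly_act_closed [simp]: "x \<in> U \<Longrightarrow> poly_act p x \<in> U"
  by (induction p) (auto simp: subspace_U subspace_0 subspace_add subspace_scale)

lemma poly_act_add: "x \<in> U \<Longrightarrow> poly_act (p + q) x = poly_act p x + poly_act q x"
  by (induction p q rule: poly_induct2) (simp_all add: F_add scale_left_distrib)

lemma poly_act_smult: "x \<in> U \<Longrightarrow> poly_act (smult c p) x = c *s poly_act p x"
  by (induction p) (simp_all add: F_scale scale_right_distrib)

lemma poly_act_minus: "x \<in> U \<Longrightarrow> poly_act (- p) x = - poly_act p x"
  using poly_act_smult[of x "-1" p] by simp

lemma poly_act_mult: "x \<in> U \<Longrightarrow> poly_act (p * q) x = poly_act p (poly_act q x)"
  by (induction p) (simp_all add: poly_act_add poly_act_smult)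

lemma poly_act_monom: "x \<in> U \<Longrightarrow> poly_act (monom 1 n) x = (F ^^ n) x"
  by (induction n) (simp_all add: monom_0 monom_Suc F_0)

text \<open>A root c of q splits off a factor X - c with cofactor p. Either p(F) x = 0 and the
  degree drops, or p(F) x is itself an eigenvector for c.\<close>

lemma eigenvector_of_poly_act_eq_0:
  assumes "q \<noteq> 0" "x \<in> U" "x \<noteq> 0" "poly_act q x = 0"
  shows "\<exists>v\<in>U. \<exists>c. v \<noteq> 0 \<and> F v = c *s v"
  using assms
proof (induction "degree q" arbitrary: q)
  case 0
  then obtain c where "q = [:c:]" "c \<noteq> 0"
    by (metis degree_eq_zeroE pCons_0_0)
  with 0 show ?case by (simp add: F_0)
next
  case (Suc n)
  have "\<not> constant (poly q)"
    using Suc.hyps(2) by (simp add: constant_degree)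
  then obtain c where "poly q c = 0"
    using fundamental_theorem_of_algebra by blast
  then obtain p where p: "q = [:- c, 1:] * p"
    unfolding poly_eq_0_iff_dvd by (rule dvdE)
  have "p \<noteq> 0" using p Suc.prems(1) by auto
  have "degree q = degree [:- c, 1:] + degree p"
    unfolding p by (rule degree_mult_eq) (use \<open>p \<noteq> 0\<close> in simp_all)
  then have deg: "degree q = Suc (degree p)" by simp
  show ?case
  proof (cases "poly_act p x = 0")
    case True
    then show ?thesis
      using Suc.hyps(1)[of p] Suc.hyps(2) deg \<open>p \<noteq> 0\<close> Suc.prems by simp
  next
    case False
    have "F (poly_act p x) = c *s poly_act p x"
      using Suc.prems poly_act_mult[of x "[:- c, 1:]" p] unfolding p
      by (simp add: F_0 del: mult_pCons_left)
    then show ?thesis using False poly_act_closed[OF Suc.prems(2), of p] by blast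
  qed
qed

text \<open>If \<open>w = F v - v \<noteq> 0\<close>, the vectors \<open>F\<^sup>-\<^sup>n p(F) w\<close> fill \<open>U\<close>; writing \<open>v\<close> itself in
  this form shows that \<open>v\<close> is killed by \<open>p (X - 1) - X\<^sup>n\<close>, which is \<open>-1\<close> at \<open>X = 1\<close>.\<close>

lemma eigenvector_of_irreducible:
  assumes "U \<noteq> {0}"
    and F': "linear_between (*s) U U F'"
    and FF': "\<And>x. x \<in> U \<Longrightarrow> F (F' x) = x"
    and F'F: "\<And>x. x \<in> U \<Longrightarrow> F' (F x) = x"
    and irreducible: "\<And>M. subspace M \<Longrightarrow> M \<subseteq> U \<Longrightarrow> F ` M \<subseteq> M \<Longrightarrow> F' ` M \<subseteq> M \<Longrightarrow> M \<noteq> {0} \<Longrightarrow> M = U"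
  shows "\<exists>v\<in>U. \<exists>c. v \<noteq> 0 \<and> F v = c *s v"
proof -
  obtain v where v: "v \<in> U" "v \<noteq> 0"
    using assms(1) subspace_0[OF subspace_U] by auto
  define w where "w = poly_act [:-1, 1:] v"
  have w: "w = F v - v" by (simp add: w_def F_0)
  have wU: "w \<in> U" unfolding w_def using v(1) by (rule poly_act_closed)
  show ?thesis
  proof (cases "w = 0")
    case True
    then show ?thesis using v by (intro bexI[of _ v] exI[of _ 1]) (auto simp: w)
  next
    case False
    \<comment> \<open>The C[F, 1/F]-submodule generated by \<open>w\<close> with denominators
      cleared: the exponent \<open>n\<close> absorbs applications of \<open>F'\<close>.\<close>
    define M where "M = {u \<in> U. \<exists>n p. (F ^^ n) u = poly_act p w}"
    have iter: "(F ^^ n) x \<in> U" if "x \<in> U" for n x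
      using that by (induction n) auto
    have "subspace M"
    proof (rule subspaceI)
      show "0 \<in> M"
        unfolding M_def using subspace_0[OF subspace_U]
        by (auto intro!: exI[of _ "0::nat"] exI[of _ "0::complex poly"])
    next
      fix x y assume "x \<in> M" "y \<in> M"
      then obtain n p k q where x: "x \<in> U" "poly_act (monom 1 n) x = poly_act p w"
        and y: "y \<in> U" "poly_act (monom 1 k) y = poly_act q w"
        by (auto simp: M_def poly_act_monom)
      have add: "poly_act r (x + y) = poly_act r x + poly_act r y" for r
        using x(1) y(1) by (induction r)
          (simp_all add: F_add scale_right_distrib algebra_simps)
      have "poly_act (monom 1 (n + k)) (x + y)
          = poly_act (monom 1 k * monom 1 n) x + poly_act (monom 1 n * monom 1 k) y"
        using x(1) y(1) by (simp add: add mult_monom add.commute)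
      also have "\<dots> = poly_act (monom 1 k * p + monom 1 n * q) w"
        using x y wU by (simp add: poly_act_mult poly_act_add)
      finally have "(F ^^ (n + k)) (x + y) = poly_act (monom 1 k * p + monom 1 n * q) w"
        using x(1) y(1) by (simp add: poly_act_monom subspace_add[OF subspace_U])
      then show "x + y \<in> M"
        using subspace_add[OF subspace_U x(1) y(1)] by (auto simp: M_def)
    next
      fix c x assume "x \<in> M"
      then obtain n p where x: "x \<in> U" "(F ^^ n) x = poly_act p w"
        by (auto simp: M_def)
      have "(F ^^ k) (c *s x) = c *s (F ^^ k) x" for k
        using x(1) by (induction k) (simp_all add: F_scale iter)
      then have "(F ^^ n) (c *s x) = poly_act (smult c p) w"
        using x(2) wU by (simp add: poly_act_smult)
      then show "c *s x \<in> M"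
        using subspace_scale[OF subspace_U x(1)] by (auto simp: M_def)
    qed
    moreover have "M \<subseteq> U" by (auto simp: M_def)
    moreover have "F ` M \<subseteq> M"
    proof
      fix y assume "y \<in> F ` M"
      then obtain x n p where x: "x \<in> U" "(F ^^ n) x = poly_act p w" "y = F x"
        by (auto simp: M_def)
      have "(F ^^ n) y = poly_act (pCons 0 p) w"
        using x(2) by (simp add: x(3) funpow_swap1 [symmetric])
      moreover have "y \<in> U" using x by simp
      ultimately show "y \<in> M" unfolding M_def by blast
    qed
    moreover have "F' ` M \<subseteq> M"
    proof
      fix y assume "y \<in> F' ` M"
      then obtain x n p where x: "x \<in> U" "(F ^^ n) x = poly_act p w" "y = F' x"
        by (auto simp: M_def)
      have "(F ^^ Suc n) y = poly_act p w"
        using x FF'[OF x(1)] by (simp add: funpow_swap1)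
      moreover have "y \<in> U" using x F' by (simp add: linear_between_def)
      ultimately show "y \<in> M" unfolding M_def by blast
    qed
    moreover have "w \<in> M"
    proof -
      have "(F ^^ 0) w = poly_act [:1:] w" by (simp add: F_0)
      then show ?thesis unfolding M_def using wU by blast
    qed
    ultimately have "M = U" using irreducible[of M] False by blast
    then obtain n p where np: "(F ^^ n) v = poly_act p w"
      using v(1) unfolding M_def by blast
    define q where "q = p * [:-1, 1:] + - monom 1 n"
    have "poly_act (p * [:-1, 1:]) v = poly_act (monom 1 n) v"
      using np v(1) by (simp only: poly_act_mult w_def poly_act_monom)
    then have "poly_act q v = 0"
      using v(1) unfolding q_def by (simp only: poly_act_add poly_act_minus right_minus)
    moreover have "poly q 1 = -1"
      by (simp add: q_def poly_monom)
    then have "q \<noteq> 0" by auto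
    ultimately show ?thesis
      using eigenvector_of_poly_act_eq_0 v by blast
  qed
qed

end

section \<open>Spanning trees and first homology\<close>

text \<open>A spanning tree rooted at \<open>s0\<close> is given by the parent \<open>par s\<close> and the depth \<open>d s\<close>
  of each vertex; \<open>par s0\<close> is junk.\<close>

locale spanning_tree =
  fixes S :: "'s set" and E :: "('s \<times> 's) set" and s0 :: 's and par :: "'s \<Rightarrow> 's" and d :: "'s \<Rightarrow> nat"
  assumes E_subset: "E \<subseteq> S \<times> S" and E_sym: "sym E" and E_irrefl: "irrefl E"
    and root: "s0 \<in> S" and depth_root: "d s0 = 0"
    and par_edge: "s \<in> S \<Longrightarrow> s \<noteq> s0 \<Longrightarrow> (par s, s) \<in> E"
    and depth_par: "s \<in> S \<Longrightarrow> s \<noteq> s0 \<Longrightarrow> d s = Suc (d (par s))"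

text \<open>Breadth-first search: \<open>d\<close> is the distance from \<open>s0\<close>, and a
  parent is the last vertex but one on a shortest path. Its depth is exactly one less because
  distance grows by at most one along an edge.\<close>

lemma spanning_tree_exists:
  assumes "connected_graph S E" "E \<subseteq> S \<times> S" "sym E" "irrefl E"
  obtains s0 par d where "spanning_tree S E s0 par d"
proof -
  obtain s0 where s0: "s0 \<in> S" using assms(1) by (auto simp: connected_graph_def)
  define d where "d s = (LEAST n. (s0, s) \<in> E ^^ n)" for s
  have reach: "(s0, s) \<in> E ^^ d s" if "s \<in> S" for s
  proof -
    have "(s0, s) \<in> E\<^sup>*" using assms(1) s0 that by (simp add: connected_graph_def)
    then obtain n where "(s0, s) \<in> E ^^ n" by (auto dest: rtrancl_imp_relpow)
    then show ?thesis unfolding d_def by (rule LeastI)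
  qed
  have "\<exists>t. (t, s) \<in> E \<and> d s = Suc (d t)" if s: "s \<in> S" "s \<noteq> s0" for s
  proof (cases "d s")
    case 0
    then show ?thesis using reach[OF s(1)] s(2) by simp
  next
    case (Suc k)
    then obtain t where t: "(s0, t) \<in> E ^^ k" "(t, s) \<in> E"
      using reach[OF s(1)] by auto
    have "d t \<le> k" unfolding d_def by (rule Least_le) (rule t(1))
    moreover have "(s0, s) \<in> E ^^ Suc (d t)"
      using reach[of t] t(2) assms(2) by auto
    then have "d s \<le> Suc (d t)" unfolding d_def[of s] by (rule Least_le)
    ultimately show ?thesis using t(2) Suc by auto
  qed
  then have "\<forall>s\<in>S - {s0}. \<exists>t. (t, s) \<in> E \<and> d s = Suc (d t)" by auto
  from bchoice[OF this] obtain par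
    where par: "\<forall>s\<in>S - {s0}. (par s, s) \<in> E \<and> d s = Suc (d (par s))" by blast
  have "d s0 = 0" unfolding d_def by (rule Least_eq_0) simp
  then have "spanning_tree S E s0 par d"
    using par s0 assms(2-4) by unfold_locales auto
  then show thesis by (rule that)
qed

context spanning_tree
begin

lemma par_in_S: "s \<in> S \<Longrightarrow> s \<noteq> s0 \<Longrightarrow> par s \<in> S"
  using par_edge E_subset by blast

lemma tree_induct [consumes 1, case_names root step]:
  assumes "s \<in> S" "P s0" "\<And>s. s \<in> S \<Longrightarrow> s \<noteq> s0 \<Longrightarrow> P (par s) \<Longrightarrow> P s"
  shows "P s"
  using assms(1)
proof (induction "d s" arbitrary: s)
  case 0
  then show ?case using assms(2) depth_par by (cases "s = s0") auto
next
  case (Suc n)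
  then have s: "s \<noteq> s0" using depth_root by auto
  then have "P (par s)" using Suc par_in_S depth_par by simp
  then show ?case using assms(3) Suc.prems s by blast
qed

text \<open>Depth justifies recursion along \<open>par\<close>: \<open>G n s\<close> unrolls n steps
  and is read off at n = d s, so for vertices of \<open>S\<close> the junk value
  \<open>par s0\<close> is never consulted.\<close>

lemma tree_recursion:
  obtains g where "g s0 = b" "\<And>s. s \<in> S \<Longrightarrow> s \<noteq> s0 \<Longrightarrow> g s = h s (g (par s))"
proof -
  define G where "G = rec_nat (\<lambda>s. b) (\<lambda>n f s. h s (f (par s)))"
  show thesis
    by (rule that[of "\<lambda>s. G (d s) s"]) (auto simp: G_def depth_root depth_par)
qed

section \<open>Fundamental cycles and the rank of the first homology\<close>

definition tree_edge :: "'s \<Rightarrow> 's \<Rightarrow> bool" where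
  "tree_edge s t \<longleftrightarrow> (t \<in> S \<and> t \<noteq> s0 \<and> s = par t) \<or> (s \<in> S \<and> s \<noteq> s0 \<and> t = par s)"

abbreviation oriented_edge :: "'s \<Rightarrow> 's \<Rightarrow> ('s \<times> 's) \<Rightarrow>\<^sub>0 int" where
  "oriented_edge s t \<equiv> frag_of (s, t) - frag_of (t, s)"

definition antisym_chain :: "(('s \<times> 's) \<Rightarrow>\<^sub>0 int) \<Rightarrow> bool" where
  "antisym_chain c \<longleftrightarrow> (\<forall>s t. Poly_Mapping.lookup c (t, s) = - Poly_Mapping.lookup c (s, t))"

lemma antisym_chain_add: "antisym_chain c \<Longrightarrow> antisym_chain c' \<Longrightarrow> antisym_chain (c + c')"
  unfolding antisym_chain_def lookup_add by (metis minus_add_distrib)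

lemma antisym_chain_cmul: "antisym_chain c \<Longrightarrow> antisym_chain (frag_cmul k c)"
  unfolding antisym_chain_def lookup_frag_cmul by (metis mult_minus_right)

lemma antisym_chain_diff: "antisym_chain c \<Longrightarrow> antisym_chain c' \<Longrightarrow> antisym_chain (c - c')"
  using antisym_chain_add[of c "frag_cmul (-1) c'"] antisym_chain_cmul[of c' "-1"] by simp

lemma antisym_chain_edge: "antisym_chain (frag_of (s, t) - frag_of (t, s))"
  unfolding antisym_chain_def lookup_minus lookup_frag_of prod.inject by (simp add: conj_commute)

lemma carrier_graph_H1_iff:
  "c \<in> carrier (graph_H1 S E) \<longleftrightarrow>
    (\<forall>e. e \<notin> E \<longrightarrow> Poly_Mapping.lookup c e = 0) \<and>
    antisym_chain c \<and> graph_boundary1 c = 0"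
  unfolding graph_H1_def graph_chains1_def kernel_def antisym_chain_def[symmetric]
  by (auto simp: in_keys_iff)

text \<open>\<open>P s\<close> is the tree path from the root to \<open>s\<close> as a chain; its
  boundary telescopes.\<close>

lemma tree_chains:
  obtains P where "\<And>s. s \<in> S \<Longrightarrow> graph_boundary1 (P s) = frag_of s - frag_of s0"
    and "\<And>s. s \<in> S \<Longrightarrow> antisym_chain (P s)"
    and "\<And>s a b. s \<in> S \<Longrightarrow> \<not> tree_edge a b \<Longrightarrow> Poly_Mapping.lookup (P s) (a, b) = 0"
proof -
  obtain P :: "'s \<Rightarrow> ('s \<times> 's) \<Rightarrow>\<^sub>0 int" where P: "P s0 = 0"
    "\<And>s. s \<in> S \<Longrightarrow> s \<noteq> s0 \<Longrightarrow> P s = P (par s) + oriented_edge (par s) s"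
    by (rule tree_recursion[where h = "\<lambda>s c. c + oriented_edge (par s) s" and b = 0]) blast
  have add: "graph_boundary1 (x + y) = graph_boundary1 x + graph_boundary1 y" for x y :: "('s \<times> 's) \<Rightarrow>\<^sub>0 int"
    by (simp add: graph_boundary1_def frag_extend_add)
  show thesis
  proof (rule that)
    show "graph_boundary1 (P s) = frag_of s - frag_of s0" if "s \<in> S" for s
      using that
    proof (induction rule: tree_induct)
      case root
      then show ?case by (simp add: P(1) graph_boundary1_def)
    next
      case (step s)
      then show ?case by (simp only: P(2)[OF step(1,2)] add graph_boundary1_edge) simp
    qed
    show "antisym_chain (P s)" if "s \<in> S" for s
      using that
    proof (induction rule: tree_induct)
      case root
      then show ?case by (simp add: P(1) antisym_chain_def)
    next
      case (step s)
      then show ?case by (simp only: P(2)[OF step(1,2)] antisym_chain_add antisym_chain_edge)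
    qed
    show "Poly_Mapping.lookup (P s) (a, b) = 0" if "s \<in> S" "\<not> tree_edge a b" for s a b
      using that(1)
    proof (induction rule: tree_induct)
      case root
      then show ?case by (simp add: P(1))
    next
      case (step s)
      then have "(a, b) \<noteq> (par s, s)" "(a, b) \<noteq> (s, par s)"
        using that(2) by (auto simp: tree_edge_def)
      then show ?case
        unfolding P(2)[OF step(1,2)] lookup_add lookup_minus lookup_frag_of step(3) by simp
    qed
  qed
qed

text \<open>Tree paths close the edge (a, b): from the root to a, across, and back from b.
  Antisymmetry forces the coefficient -1 at (b, a), hence the second exempted pair.\<close>

lemma fundamental_cycle:
  assumes "(a, b) \<in> E" "\<not> tree_edge a b"
  obtains c where "c \<in> carrier (graph_H1 S E)" "Poly_Mapping.lookup c (a, b) = 1"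
    and "\<And>x y. \<not> tree_edge x y \<Longrightarrow> (x, y) \<noteq> (a, b) \<Longrightarrow> (x, y) \<noteq> (b, a) \<Longrightarrow> Poly_Mapping.lookup c (x, y) = 0"
proof -
  obtain P where P: "\<And>s. s \<in> S \<Longrightarrow> graph_boundary1 (P s) = frag_of s - frag_of s0"
    "\<And>s. s \<in> S \<Longrightarrow> antisym_chain (P s)"
    "\<And>s a b. s \<in> S \<Longrightarrow> \<not> tree_edge a b \<Longrightarrow> Poly_Mapping.lookup (P s) (a, b) = 0"
    by (rule tree_chains) blast
  define c where "c = P a + oriented_edge a b - P b"
  have ab: "a \<in> S" "b \<in> S" "(b, a) \<in> E" "a \<noteq> b"
    using assms(1) E_subset E_sym E_irrefl by (auto dest: symD simp: irrefl_def)
  have "\<not> tree_edge x y" if "(x, y) \<notin> E" for x y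
    using that par_edge E_sym by (auto simp: tree_edge_def dest: symD)
  then have "Poly_Mapping.lookup c e = 0" if "e \<notin> E" for e
    using that assms(1) ab by (cases e) (auto simp: c_def lookup_add lookup_minus P(3))
  moreover have "antisym_chain c"
    unfolding c_def using ab P(2) by (intro antisym_chain_diff antisym_chain_add antisym_chain_edge)
  moreover have "graph_boundary1 c = graph_boundary1 (P a) + graph_boundary1 (oriented_edge a b) - graph_boundary1 (P b)"
    by (simp only: c_def graph_boundary1_def frag_extend_add frag_extend_diff)
  then have "graph_boundary1 c = 0"
    by (simp only: P(1) ab graph_boundary1_edge) simp
  ultimately have "c \<in> carrier (graph_H1 S E)"
    by (simp add: carrier_graph_H1_iff)
  moreover have "Poly_Mapping.lookup c (a, b) = 1"
    using ab assms(2) by (simp add: c_def lookup_add lookup_minus P(3))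
  moreover have "Poly_Mapping.lookup c (x, y) = 0"
    if "\<not> tree_edge x y" "(x, y) \<noteq> (a, b)" "(x, y) \<noteq> (b, a)" for x y
    using ab that by (simp add: c_def lookup_add lookup_minus P(3))
  ultimately show thesis by (rule that)
qed

text \<open>A monoid isomorphism is only known to be additive. Between abelian groups it also
  respects integer multiples, which is the form in which the rank 1 argument compares two
  cycles.\<close>

lemma graph_H1_iso:
  assumes "free_abelian_of_rank (graph_H1 S E) r"
  obtains h where "\<forall>c\<in>carrier (graph_H1 S E). Poly_Mapping.keys (h c) \<subseteq> {..<r}"
    and "\<forall>c\<in>carrier (graph_H1 S E). h c = 0 \<longrightarrow> c = 0"
    and "\<forall>c\<in>carrier (graph_H1 S E). \<forall>c'\<in>carrier (graph_H1 S E). \<forall>k l.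
      frag_cmul k c + frag_cmul l c' \<in> carrier (graph_H1 S E) \<and>
      h (frag_cmul k c + frag_cmul l c') = frag_cmul k (h c) + frag_cmul l (h c')"
proof -
  let ?H = "graph_H1 S E"
  obtain h where h: "h \<in> iso ?H (free_Abelian_group {..<r})"
    using assms by (auto simp: free_abelian_of_rank_def is_iso_def)
  have comb: "frag_cmul k c + frag_cmul l c' \<in> carrier ?H" if "c \<in> carrier ?H" "c' \<in> carrier ?H" for k l c c'
    using that unfolding carrier_graph_H1_iff
    by (simp add: antisym_chain_add antisym_chain_cmul lookup_add graph_boundary1_def
        frag_extend_add frag_extend_cmul)
  have zero: "0 \<in> carrier ?H"
    by (simp add: carrier_graph_H1_iff antisym_chain_def graph_boundary1_def)
  have closed: "c + c' \<in> carrier ?H" if "c \<in> carrier ?H" "c' \<in> carrier ?H" for c c'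
    using comb[OF that, of 1 1] by simp
  have cmul: "frag_cmul k c \<in> carrier ?H" if "c \<in> carrier ?H" for c k
    using comb[OF that that, of k 0] by simp
  have add: "h (c + c') = h c + h c'" if "c \<in> carrier ?H" "c' \<in> carrier ?H" for c c'
    using h that by (auto simp: iso_def hom_def graph_H1_def graph_chains1_def)
  have h0: "h 0 = 0" using add[OF zero zero] by simp
  have minus: "h (- c) = - h c" if "c \<in> carrier ?H" for c
    using add[OF that cmul[OF that, of "-1"]] h0 by (simp add: minus_unique)
  have nat: "h (frag_cmul (int n) c) = frag_cmul (int n) (h c)" if "c \<in> carrier ?H" for n c
    using that by (induction n) (simp_all add: h0 frag_cmul_distrib add cmul)
  have int: "h (frag_cmul k c) = frag_cmul k (h c)" if c: "c \<in> carrier ?H" for k c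
  proof (cases "k \<ge> 0")
    case True
    then show ?thesis using nat[OF c, of "nat k"] by simp
  next
    case False
    then have "h (- frag_cmul (int (nat (- k))) c) = - frag_cmul (int (nat (- k))) (h c)"
      by (subst minus[OF cmul[OF c]]) (simp only: nat[OF c])
    then show ?thesis using False by simp
  qed
  show thesis
  proof (rule that; intro ballI allI impI)
    show "Poly_Mapping.keys (h c) \<subseteq> {..<r}" if "c \<in> carrier ?H" for c
      using h that by (auto simp: iso_def dest!: hom_in_carrier[of h _ _ c])
    show "c = 0" if "c \<in> carrier ?H" "h c = 0" for c
    proof -
      have "inj_on h (carrier ?H)" using h by (simp add: iso_def bij_betw_def)
      then show ?thesis using that zero h0 by (metis inj_onD)
    qed
    show "frag_cmul k c + frag_cmul l c' \<in> carrier ?H \<and>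
      h (frag_cmul k c + frag_cmul l c') = frag_cmul k (h c) + frag_cmul l (h c')"
      if "c \<in> carrier ?H" "c' \<in> carrier ?H" for c c' k l
      using that by (simp add: comb add cmul int)
  qed
qed

text \<open>The fundamental cycle of an edge off the tree would be a nonzero element of a trivial
  group.\<close>

lemma H1_rank_0_tree:
  assumes "free_abelian_of_rank (graph_H1 S E) 0" "(a, b) \<in> E"
  shows "tree_edge a b"
proof (rule ccontr)
  assume "\<not> tree_edge a b"
  then obtain c where c: "c \<in> carrier (graph_H1 S E)" "Poly_Mapping.lookup c (a, b) = 1"
    using fundamental_cycle assms(2) by blast
  obtain h :: "(('s \<times> 's) \<Rightarrow>\<^sub>0 int) \<Rightarrow> (nat \<Rightarrow>\<^sub>0 int)"
    where h: "\<forall>c\<in>carrier (graph_H1 S E). Poly_Mapping.keys (h c) \<subseteq> {..<0}"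
      "\<forall>c\<in>carrier (graph_H1 S E). h c = 0 \<longrightarrow> c = 0"
    by (rule graph_H1_iso[OF assms(1)])
  have "c = 0" using h c(1) by simp
  then show False using c(2) by simp
qed

text \<open>Two fundamental cycles in a group \<open>\<int>\<close> would satisfy a linear relation, but each contains
  its own non-tree edge with coefficient \<open>1\<close> and the other one with coefficient \<open>0\<close>.\<close>

lemma H1_rank_1_unicyclic:
  assumes "free_abelian_of_rank (graph_H1 S E) 1"
    and "(a, b) \<in> E" "\<not> tree_edge a b" "(x, y) \<in> E" "\<not> tree_edge x y"
  shows "(x, y) = (a, b) \<or> (x, y) = (b, a)"
proof (rule ccontr)
  assume neq: "\<not> ((x, y) = (a, b) \<or> (x, y) = (b, a))"
  obtain c where c: "c \<in> carrier (graph_H1 S E)" "Poly_Mapping.lookup c (a, b) = 1"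
    "Poly_Mapping.lookup c (x, y) = 0"
    using fundamental_cycle[OF assms(2,3)] assms(5) neq by metis
  obtain c' where c': "c' \<in> carrier (graph_H1 S E)" "Poly_Mapping.lookup c' (x, y) = 1"
    "Poly_Mapping.lookup c' (a, b) = 0"
    using fundamental_cycle[OF assms(4,5)] assms(3) neq by (metis prod.inject)
  obtain h :: "(('s \<times> 's) \<Rightarrow>\<^sub>0 int) \<Rightarrow> (nat \<Rightarrow>\<^sub>0 int)"
    where h: "\<forall>c\<in>carrier (graph_H1 S E). Poly_Mapping.keys (h c) \<subseteq> {..<1}"
    "\<forall>c\<in>carrier (graph_H1 S E). h c = 0 \<longrightarrow> c = 0"
    "\<forall>c\<in>carrier (graph_H1 S E). \<forall>c'\<in>carrier (graph_H1 S E). \<forall>k l.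
      frag_cmul k c + frag_cmul l c' \<in> carrier (graph_H1 S E) \<and>
      h (frag_cmul k c + frag_cmul l c') = frag_cmul k (h c) + frag_cmul l (h c')"
    by (rule graph_H1_iso[OF assms(1)])
  have zero: "h z = 0" if "z \<in> carrier (graph_H1 S E)" "Poly_Mapping.lookup (h z) 0 = 0" for z
  proof (rule poly_mapping_eqI)
    fix n
    show "Poly_Mapping.lookup (h z) n = Poly_Mapping.lookup 0 n"
      using bspec[OF h(1) that(1)] that(2) by (cases "n = 0") (auto simp: in_keys_iff)
  qed
  \<comment> \<open>Cross-multiplication: with weights h(c') and -h(c), read as integers, the two
    images cancel.\<close>
  define k l where "k = Poly_Mapping.lookup (h c') 0" and "l = - Poly_Mapping.lookup (h c) 0"
  define z where "z = frag_cmul k c + frag_cmul l c'"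
  have z: "z \<in> carrier (graph_H1 S E)" "h z = frag_cmul k (h c) + frag_cmul l (h c')"
    using h(3) c(1) c'(1) by (simp_all add: z_def)
  have "Poly_Mapping.lookup (h z) 0 = 0"
    by (simp add: z(2) lookup_add k_def l_def)
  then have "z = 0" using zero h(2) z(1) by blast
  then have "Poly_Mapping.lookup z (a, b) = 0" "Poly_Mapping.lookup z (x, y) = 0" by simp_all
  \<comment> \<open>At (a, b) the chain \<open>z\<close> has coefficient \<open>k\<close>, so the
    image of \<open>c'\<close> vanishes.\<close>
  then have "k = 0"
    by (simp add: z_def lookup_add c c')
  then have "c' = 0" using zero h(2) c'(1) by (simp add: k_def)
  then show False using c'(2) by simp
qed

end

section \<open>Irreducible A1-representations of simply laced systems\<close>

text \<open>The group is replaced by its generators. \<open>A1\<close> is imposed on every pair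
  because the labels 2 and 3 are finite; \<open>commute\<close> and \<open>braid\<close> are (st)^2
  = 1 and (st)^3 = 1 rewritten for involutions.\<close>

locale irreducible_A1 = vector_space scale
  for scale :: "complex \<Rightarrow> 'v::ab_group_add \<Rightarrow> 'v" (infixr \<open>*s\<close> 75) +
  fixes S :: "'s set" and E :: "('s \<times> 's) set" and V :: "'v set" and \<sigma> :: "'s \<Rightarrow> 'v \<Rightarrow> 'v"
  assumes fin: "finite S" and conn: "connected_graph S E"
    and E_sub: "E \<subseteq> S \<times> S" and E_symm: "sym E" and E_irr: "irrefl E"
    and V_subspace: "subspace V"
    and \<sigma>_closed: "s \<in> S \<Longrightarrow> v \<in> V \<Longrightarrow> \<sigma> s v \<in> V"
    and \<sigma>_add: "s \<in> S \<Longrightarrow> u \<in> V \<Longrightarrow> v \<in> V \<Longrightarrow> \<sigma> s (u + v) = \<sigma> s u + \<sigma> s v"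
    and \<sigma>_scale: "s \<in> S \<Longrightarrow> v \<in> V \<Longrightarrow> \<sigma> s (c *s v) = c *s \<sigma> s v"
    and \<sigma>_square: "s \<in> S \<Longrightarrow> v \<in> V \<Longrightarrow> \<sigma> s (\<sigma> s v) = v"
    and commute: "s \<in> S \<Longrightarrow> t \<in> S \<Longrightarrow> s \<noteq> t \<Longrightarrow> (s, t) \<notin> E \<Longrightarrow> v \<in> V \<Longrightarrow> \<sigma> s (\<sigma> t v) = \<sigma> t (\<sigma> s v)"
    and braid: "(s, t) \<in> E \<Longrightarrow> v \<in> V \<Longrightarrow> \<sigma> s (\<sigma> t (\<sigma> s v)) = \<sigma> t (\<sigma> s (\<sigma> t v))"
    and A1: "s \<in> S \<Longrightarrow> t \<in> S \<Longrightarrow> s \<noteq> t \<Longrightarrow> v \<in> V \<Longrightarrow> \<sigma> s v = - v \<Longrightarrow> \<sigma> t v = - v \<Longrightarrow> v = 0"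
    and irreducible: "subspace U \<Longrightarrow> U \<subseteq> V \<Longrightarrow> (\<And>s u. s \<in> S \<Longrightarrow> u \<in> U \<Longrightarrow> \<sigma> s u \<in> U) \<Longrightarrow> U = {0} \<or> U = V"
    and nontrivial: "\<exists>s\<in>S. \<exists>v\<in>V. \<sigma> s v \<noteq> v"
begin

section \<open>Eigenspaces for -1 and the maps between them\<close>

definition neg_space :: "'s \<Rightarrow> 'v set" where
  "neg_space s = {v \<in> V. \<sigma> s v = - v}"

definition refl_diff :: "'s \<Rightarrow> 'v \<Rightarrow> 'v" where
  "refl_diff s v = \<sigma> s v - v"

lemma V_0 [simp]: "0 \<in> V"
  and V_add [simp]: "u \<in> V \<Longrightarrow> v \<in> V \<Longrightarrow> u + v \<in> V"
  and V_diff [simp]: "u \<in> V \<Longrightarrow> v \<in> V \<Longrightarrow> u - v \<in> V"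
  and V_scale [simp]: "v \<in> V \<Longrightarrow> c *s v \<in> V"
  and V_minus [simp]: "v \<in> V \<Longrightarrow> - v \<in> V"
  using V_subspace by (auto intro: subspace_0 subspace_add subspace_diff subspace_scale subspace_neg)

lemma edge_in_S: "(s, t) \<in> E \<Longrightarrow> s \<in> S \<and> t \<in> S \<and> s \<noteq> t \<and> (t, s) \<in> E"
  using E_sub E_symm E_irr by (auto dest: symD simp: irrefl_def)

lemma \<sigma>_0: "s \<in> S \<Longrightarrow> \<sigma> s 0 = 0"
  using \<sigma>_scale[of s 0 0] by simp

lemma \<sigma>_minus: "s \<in> S \<Longrightarrow> v \<in> V \<Longrightarrow> \<sigma> s (- v) = - \<sigma> s v"
  using \<sigma>_scale[of s v "-1"] by simp

lemma \<sigma>_diff: "s \<in> S \<Longrightarrow> u \<in> V \<Longrightarrow> v \<in> V \<Longrightarrow> \<sigma> s (u - v) = \<sigma> s u - \<sigma> s v"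
  using \<sigma>_add[of s u "- v"] by (simp add: \<sigma>_minus)

lemma refl_diff_closed [simp]: "s \<in> S \<Longrightarrow> v \<in> V \<Longrightarrow> refl_diff s v \<in> V"
  by (simp add: refl_diff_def \<sigma>_closed)

lemma refl_diff_add: "s \<in> S \<Longrightarrow> u \<in> V \<Longrightarrow> v \<in> V \<Longrightarrow> refl_diff s (u + v) = refl_diff s u + refl_diff s v"
  by (simp add: refl_diff_def \<sigma>_add algebra_simps)

lemma refl_diff_scale: "s \<in> S \<Longrightarrow> v \<in> V \<Longrightarrow> refl_diff s (c *s v) = c *s refl_diff s v"
  by (simp add: refl_diff_def \<sigma>_scale scale_right_diff_distrib)

lemma refl_diff_0: "s \<in> S \<Longrightarrow> refl_diff s 0 = 0"
  by (simp add: refl_diff_def \<sigma>_0)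

lemma neg_space_sub: "v \<in> neg_space s \<Longrightarrow> v \<in> V"
  by (simp add: neg_space_def)

lemma neg_space_subspace: "s \<in> S \<Longrightarrow> subspace (neg_space s)"
  by (intro subspaceI) (auto simp: neg_space_def \<sigma>_0 \<sigma>_add \<sigma>_scale)

lemma refl_diff_in_neg_space: "s \<in> S \<Longrightarrow> v \<in> V \<Longrightarrow> refl_diff s v \<in> neg_space s"
  by (simp add: neg_space_def refl_diff_def \<sigma>_diff \<sigma>_square \<sigma>_closed)

lemma refl_diff_self: "v \<in> neg_space s \<Longrightarrow> refl_diff s v = (-2) *s v"
proof -
  have "(-2) *s v = (-1 - 1) *s v" by simp
  also have "\<dots> = - v - v" by (simp only: scale_left_diff_distrib scale_minus_left scale_one)
  finally show "v \<in> neg_space s \<Longrightarrow> refl_diff s v = (-2) *s v"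
    by (simp add: refl_diff_def neg_space_def)
qed

text \<open>As s and t commute, t preserves the -1-eigenspace of s. The vector therefore lies in
  both eigenspaces and vanishes by \<open>A1\<close>.\<close>

lemma refl_diff_nonedge:
  assumes "s \<in> S" "t \<in> S" "s \<noteq> t" "(s, t) \<notin> E" "v \<in> neg_space s"
  shows "refl_diff t v = 0"
proof (rule A1[OF assms(1-3)])
  have v: "v \<in> V" "\<sigma> s v = - v" using assms(5) by (auto simp: neg_space_def)
  show "refl_diff t v \<in> V" using assms v by simp
  show "\<sigma> s (refl_diff t v) = - refl_diff t v"
    using assms v commute[of s t v] by (simp add: refl_diff_def \<sigma>_diff \<sigma>_closed \<sigma>_minus)
  show "\<sigma> t (refl_diff t v) = - refl_diff t v"
    using refl_diff_in_neg_space[OF assms(2) v(1)] by (simp add: neg_space_def)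
qed

text \<open>For \<open>v\<close> in the \<open>-1\<close>-eigenspace of \<open>s\<close>, the vector \<open>s t v - t v + v\<close> is the projection of
  \<open>v\<close> to the sign component of the dihedral group \<open>\<langle>s, t\<rangle>\<close>, up to a factor.\<close>

lemma refl_diff_edge:
  assumes "(s, t) \<in> E" "v \<in> neg_space s"
  shows "refl_diff s (refl_diff t v) = v"
proof -
  have st: "s \<in> S" "t \<in> S" "s \<noteq> t" using edge_in_S[OF assms(1)] by auto
  have v: "v \<in> V" "\<sigma> s v = - v" using assms(2) by (auto simp: neg_space_def)
  define w where "w = \<sigma> s (\<sigma> t v) - \<sigma> t v + v"
  have tst: "\<sigma> t (\<sigma> s (\<sigma> t v)) = - \<sigma> s (\<sigma> t v)"
    using braid[OF assms(1) v(1)] st v by (simp add: \<sigma>_minus \<sigma>_closed)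
  have "w = 0"
  proof (rule A1[OF st])
    show "w \<in> V" using st v by (simp add: w_def \<sigma>_closed)
    show "\<sigma> s w = - w"
      using st v by (simp add: w_def \<sigma>_add \<sigma>_diff \<sigma>_closed \<sigma>_square)
    show "\<sigma> t w = - w"
      using st v tst by (simp add: w_def \<sigma>_add \<sigma>_diff \<sigma>_closed \<sigma>_square)
  qed
  moreover have "refl_diff s (refl_diff t v) = w + v"
    using st v by (simp add: refl_diff_def w_def \<sigma>_diff \<sigma>_closed)
  ultimately show ?thesis by simp
qed

lemma refl_diff_linear:
  "t \<in> S \<Longrightarrow> linear_between (*s) (neg_space s) (neg_space t) (refl_diff t)"
  by (simp add: linear_between_def refl_diff_in_neg_space neg_space_sub refl_diff_add refl_diff_scale)

text \<open>Bookkeeping for subrepresentations. Stability is asked along edges only: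
  \<open>refl_diff t\<close> is the scalar -2 on \<open>M t\<close> and kills \<open>M s\<close> for
  s distinct from and not adjacent to t.\<close>

definition stable_family :: "('s \<Rightarrow> 'v set) \<Rightarrow> bool" where
  "stable_family M \<longleftrightarrow> (\<forall>s\<in>S. subspace (M s) \<and> M s \<subseteq> neg_space s) \<and>
    (\<forall>s t. (s, t) \<in> E \<longrightarrow> refl_diff t ` M s \<subseteq> M t)"

text \<open>Checked on generators, by the cases s = t, non-edge and edge. The conclusion is sharper
  than invariance of the span: the image lands in the single piece \<open>M t\<close>, which later
  bounds the eigenspace of t.\<close>

lemma stable_family_span:
  assumes "stable_family M" "t \<in> S" "v \<in> span (\<Union>s\<in>S. M s)"
  shows "v \<in> V \<and> refl_diff t v \<in> M t"
proof -
  have Mt: "subspace (M t)" using assms by (simp add: stable_family_def)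
  have gen: "x \<in> V \<and> refl_diff t x \<in> M t" if s: "s \<in> S" "x \<in> M s" for s x
  proof -
    have x: "x \<in> neg_space s" using assms(1) s by (auto simp: stable_family_def)
    consider "s = t" | "s \<noteq> t" "(s, t) \<notin> E" | "(s, t) \<in> E" by blast
    then have "refl_diff t x \<in> M t"
    proof cases
      case 1
      then show ?thesis using s x subspace_scale[OF Mt] by (simp only: refl_diff_self)
    next
      case 2
      then show ?thesis using refl_diff_nonedge[OF s(1) assms(2) 2 x] subspace_0[OF Mt] by simp
    next
      case 3
      then have "refl_diff t ` M s \<subseteq> M t" using assms(1) by (simp add: stable_family_def)
      then show ?thesis using s(2) by blast
    qed
    then show ?thesis using x by (simp add: neg_space_def)
  qed
  have "subspace {v \<in> V. refl_diff t v \<in> M t}"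
    using Mt assms(2) by (intro subspaceI)
      (auto simp: refl_diff_0 refl_diff_add refl_diff_scale intro: subspace_0 subspace_add subspace_scale)
  then show ?thesis
    using span_minimal[of "\<Union>s\<in>S. M s" "{v \<in> V. refl_diff t v \<in> M t}"] assms(3) gen by blast
qed

text \<open>Irreducibility makes the span all of \<open>V\<close>, so \<open>refl_diff t\<close>
  maps \<open>V\<close> into \<open>M t\<close>. Being -2 on the eigenspace of t, it leaves no room
  there outside \<open>M t\<close>.\<close>

lemma stable_family_full:
  assumes M: "stable_family M" and s: "s \<in> S" "M s \<noteq> {0}"
  shows "span (\<Union>s\<in>S. M s) = V" "\<And>t v. t \<in> S \<Longrightarrow> v \<in> V \<Longrightarrow> refl_diff t v \<in> M t"
    "\<And>t. t \<in> S \<Longrightarrow> M t = neg_space t"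
proof -
  let ?U = "span (\<Union>s\<in>S. M s)"
  have "?U = {0} \<or> ?U = V"
  proof (rule irreducible)
    show "?U \<subseteq> V" using stable_family_span[OF M s(1)] by blast
    show "\<sigma> t u \<in> ?U" if "t \<in> S" "u \<in> ?U" for t u
    proof -
      have "refl_diff t u \<in> ?U"
        using stable_family_span[OF M that] that(1) by (auto intro: span_base)
      then have "refl_diff t u + u \<in> ?U" using that(2) by (rule span_add)
      then show ?thesis by (simp add: refl_diff_def)
    qed
  qed auto
  moreover have "?U \<noteq> {0}"
  proof -
    have "0 \<in> M s" using M s by (auto simp: stable_family_def intro: subspace_0)
    then obtain x where "x \<in> M s" "x \<noteq> 0" using s(2) by blast
    then show ?thesis using s(1) span_base[of x "\<Union>s\<in>S. M s"] by blast
  qed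
  ultimately show V: "?U = V" by blast
  show d: "refl_diff t v \<in> M t" if "t \<in> S" "v \<in> V" for t v
    using stable_family_span[OF M that(1)] that(2) V by blast
  show "M t = neg_space t" if t: "t \<in> S" for t
  proof
    show "M t \<subseteq> neg_space t" using M t by (simp add: stable_family_def)
    show "neg_space t \<subseteq> M t"
    proof
      fix v assume v: "v \<in> neg_space t"
      have "subspace (M t)" using M t by (simp add: stable_family_def)
      then have "(-1/2) *s refl_diff t v \<in> M t"
        using d[OF t neg_space_sub[OF v]] by (rule subspace_scale)
      then show "v \<in> M t" using v by (simp only: refl_diff_self scale_scale) simp
    qed
  qed
qed

text \<open>Some generator acts nontrivially and so has a -1-eigenvector; the injective edge maps
  carry it along a path to \<open>s\<close>.\<close>

lemma neg_space_nonzero: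
  assumes "s \<in> S"
  shows "neg_space s \<noteq> {0}"
proof -
  obtain t v where t: "t \<in> S" "v \<in> V" "\<sigma> t v \<noteq> v" using nontrivial by blast
  have "(t, s) \<in> E\<^sup>*" using conn t(1) assms by (simp add: connected_graph_def)
  then have "\<exists>x\<in>neg_space s. x \<noteq> 0"
  proof induction
    case base
    show ?case using refl_diff_in_neg_space[OF t(1,2)] t(3)
      by (intro bexI[of _ "refl_diff t v"]) (simp_all add: refl_diff_def)
  next
    case (step y z)
    then obtain x where x: "x \<in> neg_space y" "x \<noteq> 0" by blast
    have yz: "y \<in> S" "z \<in> S" using edge_in_S[OF step(2)] by auto
    have "refl_diff z x \<noteq> 0" using refl_diff_edge[OF step(2) x(1)] x(2) refl_diff_0[OF yz(1)] by auto
    then show ?case using refl_diff_in_neg_space[OF yz(2) neg_space_sub[OF x(1)]] by blast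
  qed
  then show ?thesis by blast
qed

text \<open>The fixed vectors form a subrepresentation, and by nontriviality it is not all of
  \<open>V\<close>.\<close>

lemma fixed_vector_0:
  assumes "v \<in> V" "\<And>s. s \<in> S \<Longrightarrow> refl_diff s v = 0"
  shows "v = 0"
proof -
  let ?U = "{v \<in> V. \<forall>s\<in>S. \<sigma> s v = v}"
  have "?U = {0} \<or> ?U = V"
    by (rule irreducible) (auto intro!: subspaceI simp: \<sigma>_0 \<sigma>_add \<sigma>_scale)
  moreover have "?U \<noteq> V" using nontrivial by blast
  moreover have "v \<in> ?U" using assms by (simp add: refl_diff_def)
  ultimately show ?thesis by blast
qed

text \<open>A common eigenvector of the monodromy, transported along the tree, spans a stable family of
  lines; the monodromy is the holonomy around the unique cycle when \<open>(a, b)\<close> is an edge.\<close>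

lemma root_vectors_exist:
  assumes "spanning_tree S E s0 par d"
    and cyc: "\<And>s t. (s, t) \<in> E \<Longrightarrow> spanning_tree.tree_edge S s0 par s t \<or> (s, t) = (a, b) \<or> (s, t) = (b, a)"
  obtains \<alpha> where "\<And>s. s \<in> S \<Longrightarrow> \<alpha> s \<in> neg_space s" "\<And>s. s \<in> S \<Longrightarrow> \<alpha> s \<noteq> 0"
    and "\<And>s. s \<in> S \<Longrightarrow> s \<noteq> s0 \<Longrightarrow> \<alpha> s = refl_diff s (\<alpha> (par s))"
    and "span (\<alpha> ` S) = V" "\<And>s v. s \<in> S \<Longrightarrow> v \<in> V \<Longrightarrow> refl_diff s v \<in> span {\<alpha> s}"
proof -
  interpret spanning_tree S E s0 par d by fact
  let ?U = "neg_space s0"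
  \<comment> \<open>Transport from the root to \<open>s\<close> along the tree;
    \<open>\<Psi> s\<close> retraces the same path back to the root.\<close>
  obtain \<Phi> :: "'s \<Rightarrow> 'v \<Rightarrow> 'v" where \<Phi>0: "\<Phi> s0 = (\<lambda>x. x)"
    and \<Phi>: "\<And>s. s \<in> S \<Longrightarrow> s \<noteq> s0 \<Longrightarrow> \<Phi> s = (\<lambda>x. refl_diff s (\<Phi> (par s) x))"
    by (rule tree_recursion[where h = "\<lambda>s f x. refl_diff s (f x)" and b = "\<lambda>x. x"]) blast
  obtain \<Psi> :: "'s \<Rightarrow> 'v \<Rightarrow> 'v" where \<Psi>0: "\<Psi> s0 = (\<lambda>x. x)"
    and \<Psi>: "\<And>s. s \<in> S \<Longrightarrow> s \<noteq> s0 \<Longrightarrow> \<Psi> s = (\<lambda>x. \<Psi> (par s) (refl_diff (par s) x))"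
    by (rule tree_recursion[where h = "\<lambda>s f x. f (refl_diff (par s) x)" and b = "\<lambda>x. x"]) blast
  have lin: "linear_between (*s) ?U (neg_space s) (\<Phi> s) \<and> linear_between (*s) (neg_space s) ?U (\<Psi> s)"
    if "s \<in> S" for s
    using that
  proof (induction rule: tree_induct)
    case root
    then show ?case by (simp add: \<Phi>0 \<Psi>0 linear_between_def)
  next
    case (step s)
    have "linear_between (*s) ?U (neg_space s) (\<lambda>x. refl_diff s (\<Phi> (par s) x))"
      by (rule linear_between_comp[OF conjunct1[OF step(3)] refl_diff_linear[OF step(1)]])
    moreover have "linear_between (*s) (neg_space s) ?U (\<lambda>x. \<Psi> (par s) (refl_diff (par s) x))"
      by (rule linear_between_comp[OF refl_diff_linear[OF par_in_S[OF step(1,2)]] conjunct2[OF step(3)]])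
    ultimately show ?case by (simp only: \<Phi>[OF step(1,2)] \<Psi>[OF step(1,2)])
  qed
  have \<Phi>_mem: "\<Phi> s x \<in> neg_space s" if "s \<in> S" "x \<in> ?U" for s x
    using lin[OF that(1)] that(2) by (simp add: linear_between_def)
  have \<Psi>_mem: "\<Psi> s x \<in> ?U" if "s \<in> S" "x \<in> neg_space s" for s x
    using lin[OF that(1)] that(2) by (simp add: linear_between_def)
  have inv: "(\<forall>x\<in>?U. \<Psi> s (\<Phi> s x) = x) \<and> (\<forall>x\<in>neg_space s. \<Phi> s (\<Psi> s x) = x)" if "s \<in> S" for s
    using that
  proof (induction rule: tree_induct)
    case root
    then show ?case by (simp add: \<Phi>0 \<Psi>0)
  next
    case (step s)
    note p = par_in_S[OF step(1,2)]
    have e: "(par s, s) \<in> E" "(s, par s) \<in> E" using par_edge[OF step(1,2)] edge_in_S by auto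
    have "refl_diff (par s) x \<in> neg_space (par s)" if "x \<in> neg_space s" for x
      using p that by (intro refl_diff_in_neg_space neg_space_sub)
    then show ?case
      using step(3) by (simp add: \<Phi>[OF step(1,2)] \<Psi>[OF step(1,2)] refl_diff_edge[OF e(1)]
          refl_diff_edge[OF e(2)] \<Phi>_mem[OF p])
  qed
  have tree: "refl_diff t (\<Phi> s x) = \<Phi> t x" if "tree_edge s t" "x \<in> ?U" for s t x
    using that(1) unfolding tree_edge_def
  proof (elim disjE conjE)
    assume t: "s \<in> S" "s \<noteq> s0" "t = par s"
    have "(t, s) \<in> E" using par_edge t by simp
    then show ?thesis
      using \<Phi>[OF t(1,2)] t refl_diff_edge[of t s] \<Phi>_mem[OF par_in_S[OF t(1,2)] that(2)] by simp
  qed (simp add: \<Phi>)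
  \<comment> \<open>Out to a, across the edge, home from b. If (a, b) is no edge, the monodromy is
    the identity and every nonzero vector of \<open>?U\<close> is an eigenvector.\<close>
  define F where "F x = (if (a, b) \<in> E then \<Psi> b (refl_diff b (\<Phi> a x)) else x)" for x
  define F' where "F' x = (if (a, b) \<in> E then \<Psi> a (refl_diff a (\<Phi> b x)) else x)" for x
  have hol: "refl_diff b (\<Phi> a x) = \<Phi> b (F x)" "refl_diff a (\<Phi> b x) = \<Phi> a (F' x)"
    "F (F' x) = x" "F' (F x) = x" if "(a, b) \<in> E" "x \<in> ?U" for x
  proof -
    have ab: "a \<in> S" "b \<in> S" "(b, a) \<in> E" using edge_in_S[OF that(1)] by auto
    have 1: "refl_diff b y \<in> neg_space b" "refl_diff a (refl_diff b y) = y" if "y \<in> neg_space a" for y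
      using that ab refl_diff_edge[OF \<open>(a, b) \<in> E\<close>] by (auto intro: refl_diff_in_neg_space neg_space_sub)
    have 2: "refl_diff a y \<in> neg_space a" "refl_diff b (refl_diff a y) = y" if "y \<in> neg_space b" for y
      using that ab refl_diff_edge[OF ab(3)] by (auto intro: refl_diff_in_neg_space neg_space_sub)
    show "refl_diff b (\<Phi> a x) = \<Phi> b (F x)" "refl_diff a (\<Phi> b x) = \<Phi> a (F' x)"
      "F (F' x) = x" "F' (F x) = x"
      using that ab inv by (simp_all add: F_def F'_def 1 2 \<Phi>_mem)
  qed
  have FF': "F (F' x) = x" "F' (F x) = x" if "x \<in> ?U" for x
    using hol[OF _ that] by (auto simp: F_def F'_def)
  have linF: "linear_between (*s) ?U ?U F" "linear_between (*s) ?U ?U F'"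
  proof -
    have "linear_between (*s) ?U ?U (\<lambda>x. \<Psi> t (refl_diff t (\<Phi> s x)))" if "s \<in> S" "t \<in> S" for s t
      by (rule linear_between_comp[where F = "\<lambda>x. refl_diff t (\<Phi> s x)"])
        (use lin that refl_diff_linear in \<open>auto intro: linear_between_comp\<close>)
    then show "linear_between (*s) ?U ?U F" "linear_between (*s) ?U ?U F'"
      using edge_in_S unfolding F_def F'_def
      by (cases "(a, b) \<in> E"; auto simp: linear_between_def)+
  qed
  have stable: "stable_family (\<lambda>s. \<Phi> s ` M)"
    if M: "subspace M" "M \<subseteq> ?U" "F ` M \<subseteq> M" "F' ` M \<subseteq> M" for M
    unfolding stable_family_def
  proof (intro conjI ballI allI impI)
    fix s assume s: "s \<in> S"
    show "\<Phi> s ` M \<subseteq> neg_space s" using \<Phi>_mem[OF s] M(2) by blast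
    have l: "\<Phi> s (x + y) = \<Phi> s x + \<Phi> s y" "\<Phi> s (c *s x) = c *s \<Phi> s x" if "x \<in> M" "y \<in> M" for x y c
      using lin[OF s] subsetD[OF M(2) that(1)] subsetD[OF M(2) that(2)]
      by (simp_all add: linear_between_def)
    show "subspace (\<Phi> s ` M)"
    proof (rule subspaceI)
      have "\<Phi> s (0 *s 0) = 0" using l(2)[of 0 0 0] subspace_0[OF M(1)] by simp
      then show "0 \<in> \<Phi> s ` M" using subspace_0[OF M(1)] by (auto intro: rev_image_eqI)
    qed (use M(1) in \<open>auto simp: l[symmetric] intro: subspace_add subspace_scale\<close>)
  next
    fix s t assume e: "(s, t) \<in> E"
    show "refl_diff t ` \<Phi> s ` M \<subseteq> \<Phi> t ` M"
    proof clarify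
      fix x assume x: "x \<in> M"
      then have xU: "x \<in> ?U" using M(2) by blast
      \<comment> \<open>The three values belong to tree edges, to (a, b) and to (b, a).\<close>
      have "refl_diff t (\<Phi> s x) \<in> {\<Phi> t x, \<Phi> t (F x), \<Phi> t (F' x)}"
        using cyc[OF e] tree[OF _ xU] hol[OF _ xU] e edge_in_S by auto
      then show "refl_diff t (\<Phi> s x) \<in> \<Phi> t ` M" using x M(3,4) by blast
    qed
  qed
  interpret subspace_endomorphism scale ?U F
    by unfold_locales (use neg_space_subspace root linF in auto)
  have "\<exists>v\<in>?U. \<exists>c. v \<noteq> 0 \<and> F v = c *s v"
  proof (rule eigenvector_of_irreducible[OF neg_space_nonzero[OF root] linF(2) FF'])
    fix M assume M: "subspace M" "M \<subseteq> ?U" "F ` M \<subseteq> M" "F' ` M \<subseteq> M" "M \<noteq> {0}"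
    \<comment> \<open>A subspace stable under the monodromy and its inverse spreads along the tree
      to a stable family, whose member at the root is \<open>M\<close> again because
      \<open>\<Phi> s0\<close> is the identity.\<close>
    show "M = ?U"
      using stable_family_full(3)[OF stable[OF M(1-4)] root _ root] M(5) by (simp add: \<Phi>0)
  qed
  then obtain v c where v: "v \<in> ?U" "v \<noteq> 0" "F v = c *s v" by blast
  \<comment> \<open>The line of \<open>v\<close> has to be stable under the inverse monodromy
    \<open>F'\<close> as well, with eigenvalue 1/c.\<close>
  have "c \<noteq> 0"
    using FF'(2)[OF v(1)] v FF'(2)[of 0] subspace_0[OF subspace_U] F_0 by auto
  have "v = c *s F' v"
    using FF'(2)[OF v(1)] linF(2) v(1,3) by (simp add: linear_between_def)
  then have F'v: "F' v = inverse c *s v"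
    using \<open>c \<noteq> 0\<close> by (metis left_inverse scale_one scale_scale)
  define \<alpha> where "\<alpha> s = \<Phi> s v" for s
  have lines: "\<Phi> s ` span {v} = span {\<alpha> s}" if "s \<in> S" for s
    using lin[OF that] v(1) by (auto simp: span_singleton \<alpha>_def linear_between_def image_image)
  have "F ` span {v} \<subseteq> span {v}" "F' ` span {v} \<subseteq> span {v}"
    using linF v(1,3) F'v by (auto simp: span_singleton linear_between_def)
  moreover have "span {v} \<subseteq> ?U"
    using v(1) neg_space_subspace[OF root] by (intro span_minimal) auto
  ultimately have st: "stable_family (\<lambda>s. \<Phi> s ` span {v})"
    by (intro stable) auto
  have ne: "\<Phi> s0 ` span {v} \<noteq> {0}"
    using v(2) span_base[of v "{v}"] by (auto simp: \<Phi>0)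
  note full = stable_family_full[OF st root ne]
  show thesis
  proof (rule that[of \<alpha>])
    show a: "\<alpha> s \<in> neg_space s" if "s \<in> S" for s
      using \<Phi>_mem[OF that v(1)] by (simp add: \<alpha>_def)
    show "\<alpha> s \<noteq> 0" if "s \<in> S" for s
    proof
      assume "\<alpha> s = 0"
      then have "neg_space s = {0}" using full(3)[OF that] lines[OF that] by simp
      then show False using neg_space_nonzero[OF that] by simp
    qed
    show "\<alpha> s = refl_diff s (\<alpha> (par s))" if "s \<in> S" "s \<noteq> s0" for s
      using \<Phi>[OF that] by (simp add: \<alpha>_def)
    have aV: "\<alpha> ` S \<subseteq> V" using a neg_space_sub by blast
    show "span (\<alpha> ` S) = V"
    proof
      show "span (\<alpha> ` S) \<subseteq> V" using aV V_subspace by (rule span_minimal)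
      have "(\<Union>s\<in>S. \<Phi> s ` span {v}) \<subseteq> span (\<alpha> ` S)"
        using lines span_mono[of "{\<alpha> s}" "\<alpha> ` S" for s] by fastforce
      then show "V \<subseteq> span (\<alpha> ` S)" using full(1) span_minimal subspace_span by metis
    qed
    show "refl_diff s x \<in> span {\<alpha> s}" if "s \<in> S" "x \<in> V" for s x
      using full(2)[OF that] lines[OF that(1)] by simp
  qed
qed

end

text \<open>The Cartan matrix: 2 on the diagonal and -2 cos(pi / m) off it, for m = 3 on edges and m
  = 2 elsewhere.\<close>

definition root_pairing :: "('s \<times> 's) set \<Rightarrow> 's \<Rightarrow> 's \<Rightarrow> complex" where
  "root_pairing E s t = (if s = t then 2 else if (s, t) \<in> E then -1 else 0)"

context irreducible_A1
begin

text \<open>Multiples of y stay in the -1-eigenspace of t, which meets that of r only in 0.\<close>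

lemma root_vectors_independent:
  assumes "r \<in> S" "t \<in> S" "r \<noteq> t" "x \<in> neg_space r" "y \<in> neg_space t" "x \<noteq> 0" "y \<noteq> 0"
  shows "x \<noteq> y \<and> independent {x, y}"
proof -
  have "x \<notin> span {y}"
  proof
    assume "x \<in> span {y}"
    then have "x \<in> neg_space t"
      using assms(2,5) span_minimal[of "{y}" "neg_space t"] neg_space_subspace by blast
    then show False using A1[OF assms(1-3)] assms(4,6) by (auto simp: neg_space_def)
  qed
  moreover from this have "x \<noteq> y" using span_base[of y "{y}"] by blast
  ultimately show ?thesis using assms(7) by (simp add: independent_insert)
qed

text \<open>An involution splits \<open>V\<close> into its fixed space and its -1-eigenspace; the
  last hypothesis shrinks the latter to the line of x.\<close>

lemma fixed_hyperplane:
  assumes "s \<in> S" "x \<in> neg_space s" "x \<noteq> 0" "\<And>v. v \<in> V \<Longrightarrow> refl_diff s v \<in> span {x}"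
  shows "codim1_subspace (*s) V {v \<in> V. \<sigma> s v = v}"
proof -
  let ?H = "{v \<in> V. \<sigma> s v = v}"
  have x: "x \<in> V" using assms(2) by (rule neg_space_sub)
  have "subspace ?H"
    by (intro subspaceI) (auto simp: \<sigma>_0 \<sigma>_add \<sigma>_scale assms(1))
  moreover have "x \<notin> ?H"
    using assms(2,3) refl_diff_self[OF assms(2)] by (auto simp: refl_diff_def)
  moreover have "span (insert x ?H) = V"
  proof
    show "span (insert x ?H) \<subseteq> V" using x V_subspace by (intro span_minimal) auto
    show "V \<subseteq> span (insert x ?H)"
    proof
      fix v assume v: "v \<in> V"
      define w where "w = refl_diff s v"
      have w: "w \<in> neg_space s" unfolding w_def using assms(1) v by (rule refl_diff_in_neg_space)
      have wV: "w \<in> V" using w by (rule neg_space_sub)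
      \<comment> \<open>As \<open>refl_diff s\<close> is -2 on \<open>w\<close>, half of
        \<open>w\<close> is the correction that turns v into a fixed vector.\<close>
      have "refl_diff s (v + (1/2) *s w) = w + (1/2) *s ((-2) *s w)"
        using assms(1) v wV
        by (simp only: refl_diff_add V_scale refl_diff_scale refl_diff_self[OF w] w_def[symmetric])
      then have "v + (1/2) *s w \<in> ?H"
        using v wV by (simp add: refl_diff_def)
      moreover have "w \<in> span (insert x ?H)"
        using assms(4)[OF v] span_mono[of "{x}" "insert x ?H"] by (auto simp: w_def)
      ultimately have "(v + (1/2) *s w) - (1/2) *s w \<in> span (insert x ?H)"
        by (intro span_diff span_scale) (auto intro: span_base)
      then show "v \<in> span (insert x ?H)" by simp
    qed
  qed
  ultimately show ?thesis
    using x unfolding codim1_subspace_def by blast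
qed

text \<open>Matching root vectors along every edge in both directions means that the monodromy is
  trivial, as it is over a tree.\<close>

context
  fixes \<alpha> :: "'s \<Rightarrow> 'v"
  assumes \<alpha>_neg: "\<And>s. s \<in> S \<Longrightarrow> \<alpha> s \<in> neg_space s"
    and \<alpha>_edge: "\<And>s t. (s, t) \<in> E \<Longrightarrow> refl_diff t (\<alpha> s) = \<alpha> t"
    and \<alpha>_nonzero: "\<And>s. s \<in> S \<Longrightarrow> \<alpha> s \<noteq> 0"
begin

lemma refl_diff_root_sum:
  assumes "t \<in> S"
  shows "refl_diff t (\<Sum>s\<in>S. c s *s \<alpha> s) = (\<Sum>s\<in>S. - c s * root_pairing E s t) *s \<alpha> t"
proof -
  have one: "refl_diff t (\<alpha> s) = - root_pairing E s t *s \<alpha> t" if "s \<in> S" for s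
    using that assms \<alpha>_neg[OF that] \<alpha>_edge[of s t] refl_diff_nonedge[of s t "\<alpha> s"] refl_diff_self[of "\<alpha> s" s]
    by (auto simp: root_pairing_def)
  \<comment> \<open>Additivity is known on \<open>V\<close> only, so the induction carries
    membership of the partial sums along.\<close>
  have "(\<Sum>s\<in>A. c s *s \<alpha> s) \<in> V \<and>
      refl_diff t (\<Sum>s\<in>A. c s *s \<alpha> s) = (\<Sum>s\<in>A. - c s * root_pairing E s t) *s \<alpha> t"
    if "finite A" "A \<subseteq> S" for A
    using that
  proof (induction A rule: finite_induct)
    case empty
    then show ?case using assms by (simp add: refl_diff_0)
  next
    case (insert s A)
    then have s: "s \<in> S" "\<alpha> s \<in> V" using \<alpha>_neg neg_space_sub by auto
    have "refl_diff t (c s *s \<alpha> s) = (- c s * root_pairing E s t) *s \<alpha> t"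
      using s assms by (simp add: refl_diff_scale one)
    then show ?case
      using insert s assms by (simp add: refl_diff_add scale_left_distrib scale_left_diff_distrib)
  qed
  then show ?thesis using fin by simp
qed

text \<open>The linear relations among the root vectors form the radical of the Cartan form.\<close>

lemma root_sum_eq_0_iff:
  "(\<Sum>s\<in>S. c s *s \<alpha> s) = 0 \<longleftrightarrow> (\<forall>t\<in>S. (\<Sum>s\<in>S. - c s * root_pairing E s t) = 0)"
proof
  assume 0: "(\<Sum>s\<in>S. c s *s \<alpha> s) = 0"
  show "\<forall>t\<in>S. (\<Sum>s\<in>S. - c s * root_pairing E s t) = 0"
  proof
    fix t assume t: "t \<in> S"
    then have "(\<Sum>s\<in>S. - c s * root_pairing E s t) *s \<alpha> t = 0"
      using refl_diff_root_sum[OF t, of c] 0 refl_diff_0 by simp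
    then show "(\<Sum>s\<in>S. - c s * root_pairing E s t) = 0"
      using \<alpha>_nonzero[OF t] by (simp only: scale_eq_0_iff) simp
  qed
next
  assume 0: "\<forall>t\<in>S. (\<Sum>s\<in>S. - c s * root_pairing E s t) = 0"
  have "(\<Sum>s\<in>S. c s *s \<alpha> s) \<in> V"
    using V_subspace by (rule subspace_sum) (rule V_scale[OF neg_space_sub[OF \<alpha>_neg]])
  moreover have "refl_diff t (\<Sum>s\<in>S. c s *s \<alpha> s) = 0" if "t \<in> S" for t
    using 0 that by (simp only: refl_diff_root_sum scale_zero_left)
  ultimately show "(\<Sum>s\<in>S. c s *s \<alpha> s) = 0"
    by (rule fixed_vector_0)
qed

end

end

text \<open>Coefficients are indexed by \<open>S\<close> and not by the image, so \<open>f\<close>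
  may repeat values and relations of the family stay visible.\<close>

lemma (in vector_space) span_finite_family:
  assumes "finite S"
  shows "span (f ` S) = range (\<lambda>c. \<Sum>s\<in>S. c s *s f s)"
proof
  show "span (f ` S) \<subseteq> range (\<lambda>c. \<Sum>s\<in>S. c s *s f s)"
  proof (rule span_minimal)
    show "f ` S \<subseteq> range (\<lambda>c. \<Sum>s\<in>S. c s *s f s)"
    proof clarify
      fix t assume "t \<in> S"
      then have "f t = (\<Sum>s\<in>S. (if s = t then 1 else 0) *s f s)"
        using assms by (simp add: if_distrib[of "\<lambda>a. a *s _"] cong: if_cong)
      then show "f t \<in> range (\<lambda>c. \<Sum>s\<in>S. c s *s f s)"
        by (rule range_eqI[where x = "\<lambda>s. if s = t then 1 else 0"])
    qed
    show "subspace (range (\<lambda>c. \<Sum>s\<in>S. c s *s f s))"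
    proof (rule subspaceI)
      show "0 \<in> range (\<lambda>c. \<Sum>s\<in>S. c s *s f s)"
        by (rule range_eqI[of _ _ "\<lambda>s. 0"]) simp
    next
      fix x y assume "x \<in> range (\<lambda>c. \<Sum>s\<in>S. c s *s f s)" "y \<in> range (\<lambda>c. \<Sum>s\<in>S. c s *s f s)"
      then obtain c d where "x = (\<Sum>s\<in>S. c s *s f s)" "y = (\<Sum>s\<in>S. d s *s f s)" by blast
      then have "x + y = (\<Sum>s\<in>S. (c s + d s) *s f s)"
        by (simp add: scale_left_distrib sum.distrib)
      then show "x + y \<in> range (\<lambda>c. \<Sum>s\<in>S. c s *s f s)"
        by (rule range_eqI[where x = "\<lambda>s. c s + d s"])
    next
      fix a x assume "x \<in> range (\<lambda>c. \<Sum>s\<in>S. c s *s f s)"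
      then obtain c where "x = (\<Sum>s\<in>S. c s *s f s)" by blast
      then have "a *s x = (\<Sum>s\<in>S. (a * c s) *s f s)"
        by (simp add: scale_sum_right)
      then show "a *s x \<in> range (\<lambda>c. \<Sum>s\<in>S. c s *s f s)"
        by (rule range_eqI[where x = "\<lambda>s. a * c s"])
    qed
  qed
  show "range (\<lambda>c. \<Sum>s\<in>S. c s *s f s) \<subseteq> span (f ` S)"
  proof clarify
    fix c
    show "(\<Sum>s\<in>S. c s *s f s) \<in> span (f ` S)"
      by (intro span_sum span_scale) (simp add: span_base)
  qed
qed

text \<open>Both spaces are quotients of the coefficient space by the same relations, and
  \<open>f\<close> is the induced map. By \<open>rel'\<close> its values do not depend on the chosen
  coefficients.\<close>

lemma linear_iso_of_same_relations:
  fixes scale :: "complex \<Rightarrow> 'v::ab_group_add \<Rightarrow> 'v" and scale' :: "complex \<Rightarrow> 'w::ab_group_add \<Rightarrow> 'w"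
  assumes "vector_space scale" "vector_space scale'" "finite S"
    and V: "module.span scale (\<alpha> ` S) = V" and V': "module.span scale' (\<alpha>' ` S) = V'"
    and rel: "\<And>c. (\<Sum>s\<in>S. scale (c s) (\<alpha> s)) = 0 \<longleftrightarrow> (\<Sum>s\<in>S. scale' (c s) (\<alpha>' s)) = 0"
  obtains f where "bij_betw f V V'" "\<And>u v. u \<in> V \<Longrightarrow> v \<in> V \<Longrightarrow> f (u + v) = f u + f v"
    and "\<And>c v. v \<in> V \<Longrightarrow> f (scale c v) = scale' c (f v)" "\<And>s. s \<in> S \<Longrightarrow> f (\<alpha> s) = \<alpha>' s"
proof -
  interpret v: vector_space scale by fact
  interpret w: vector_space scale' by fact
  define comb where "comb c = (\<Sum>s\<in>S. scale (c s) (\<alpha> s))" for c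
  define comb' where "comb' c = (\<Sum>s\<in>S. scale' (c s) (\<alpha>' s))" for c
  have VV: "V = range comb" "V' = range comb'"
    using V V' v.span_finite_family[OF assms(3), of \<alpha>] w.span_finite_family[OF assms(3), of \<alpha>']
    by (simp_all add: comb_def[abs_def] comb'_def[abs_def])
  have add: "comb (\<lambda>s. c s + d s) = comb c + comb d" "comb' (\<lambda>s. c s + d s) = comb' c + comb' d" for c d
    by (simp_all add: comb_def comb'_def v.scale_left_distrib w.scale_left_distrib sum.distrib)
  have diff: "comb (\<lambda>s. c s - d s) = comb c - comb d" "comb' (\<lambda>s. c s - d s) = comb' c - comb' d" for c d
    by (simp_all add: comb_def comb'_def v.scale_left_diff_distrib w.scale_left_diff_distrib sum_subtractf)
  have scale: "comb (\<lambda>s. a * c s) = scale a (comb c)" "comb' (\<lambda>s. a * c s) = scale' a (comb' c)" for a c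
    by (simp_all add: comb_def comb'_def v.scale_sum_right w.scale_sum_right)
  have rel': "comb c = comb d \<longleftrightarrow> comb' c = comb' d" for c d
    using rel[of "\<lambda>s. c s - d s"] diff[of c d] by (simp add: comb_def comb'_def)
  define f where "f v = comb' (SOME c. comb c = v)" for v
  have f: "f (comb c) = comb' c" for c
    unfolding f_def using rel' someI[of "\<lambda>d. comb d = comb c" c] by blast
  show thesis
  proof (rule that[of f])
    show "bij_betw f V V'"
      unfolding bij_betw_def VV by (auto simp: inj_on_def f rel' image_image)
    show "f (x + y) = f x + f y" if xy: "x \<in> V" "y \<in> V" for x y
    proof -
      obtain c d where "x = comb c" "y = comb d" using xy VV(1) by blast
      then show ?thesis by (simp add: add[symmetric] f)
    qed
    show "f (scale a x) = scale' a (f x)" if x: "x \<in> V" for a x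
    proof -
      obtain c where "x = comb c" using x VV(1) by blast
      then show ?thesis by (simp add: scale[symmetric] f)
    qed
    show "f (\<alpha> t) = \<alpha>' t" if "t \<in> S" for t
    proof -
      have "comb (\<lambda>s. if s = t then 1 else 0) = \<alpha> t" "comb' (\<lambda>s. if s = t then 1 else 0) = \<alpha>' t"
        using that assms(3)
        by (simp_all add: comb_def comb'_def if_distrib[of "\<lambda>a. scale a _"]
            if_distrib[of "\<lambda>a. scale' a _"] cong: if_cong)
      then show ?thesis using f by metis
    qed
  qed
qed

section \<open>Passing between representations and reflections\<close>

lemma simply_laced_edges:
  assumes "coxeter_system S m" "simply_laced S m"
  shows "coxeter_edges S m \<subseteq> S \<times> S" "sym (coxeter_edges S m)" "irrefl (coxeter_edges S m)"
    and "(s, t) \<in> coxeter_edges S m \<Longrightarrow> m s t = enat 3"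
    and "s \<in> S \<Longrightarrow> t \<in> S \<Longrightarrow> s \<noteq> t \<Longrightarrow> (s, t) \<notin> coxeter_edges S m \<Longrightarrow> m s t = enat 2"
proof -
  show "coxeter_edges S m \<subseteq> S \<times> S" "irrefl (coxeter_edges S m)"
    by (auto simp: coxeter_edges_def irrefl_def)
  show "sym (coxeter_edges S m)"
    using assms(1) by (intro symI) (auto simp: coxeter_edges_def coxeter_system_def)
  have 3: "(3::enat) = enat 3" "(2::enat) = enat 2" by (simp_all add: numeral_eq_enat)
  show "m s t = enat 3" if e: "(s, t) \<in> coxeter_edges S m"
  proof -
    have "m s t = 2 \<or> m s t = 3" "3 \<le> m s t"
      using assms(2) e by (auto simp: coxeter_edges_def simply_laced_def)
    then show ?thesis by (auto simp: 3)
  qed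
  show "m s t = enat 2" if st: "s \<in> S" "t \<in> S" "s \<noteq> t" "(s, t) \<notin> coxeter_edges S m"
  proof -
    have "m s t = 2 \<or> m s t = 3" "\<not> 3 \<le> m s t"
      using assms(2) st by (auto simp: coxeter_edges_def simply_laced_def)
    then show ?thesis by (auto simp: 3)
  qed
qed

lemma coxeter_gen_pow_action:
  assumes "group_action (coxeter_group S m) V \<rho>" "s \<in> S" "t \<in> S" "v \<in> V" "s \<noteq> t" "m s t = enat k"
  shows "((\<lambda>x. \<rho> (coxeter_gen S m s) (\<rho> (coxeter_gen S m t) x)) ^^ k) v = v"
proof -
  let ?G = "coxeter_group S m"
  interpret group ?G by (rule group_coxeter_group)
  interpret group_action ?G V \<rho> by fact
  let ?g = "coxeter_gen S m s" and ?h = "coxeter_gen S m t"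
  have gh: "?g \<in> carrier ?G" "?h \<in> carrier ?G" using assms(2,3) by (auto intro: coxeter_gen_closed)
  have one: "\<rho> \<one>\<^bsub>?G\<^esub> v = v" using id_eq_one assms(4) by (metis restrict_apply')
  have "\<rho> ((?g \<otimes>\<^bsub>?G\<^esub> ?h) [^]\<^bsub>?G\<^esub> n) v = ((\<lambda>x. \<rho> ?g (\<rho> ?h x)) ^^ n) v" for n :: nat
  proof (induction n)
    case 0
    then show ?case using one by simp
  next
    case (Suc n)
    have p: "(?g \<otimes>\<^bsub>?G\<^esub> ?h) [^]\<^bsub>?G\<^esub> n \<in> carrier ?G" using gh by simp
    have "\<rho> ((?g \<otimes>\<^bsub>?G\<^esub> ?h) [^]\<^bsub>?G\<^esub> Suc n) v
        = \<rho> (?g \<otimes>\<^bsub>?G\<^esub> (?h \<otimes>\<^bsub>?G\<^esub> (?g \<otimes>\<^bsub>?G\<^esub> ?h) [^]\<^bsub>?G\<^esub> n)) v"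
      using gh p by (subst nat_pow_Suc2) (simp_all add: m_assoc)
    also have "\<dots> = \<rho> ?g (\<rho> ?h (\<rho> ((?g \<otimes>\<^bsub>?G\<^esub> ?h) [^]\<^bsub>?G\<^esub> n) v))"
      using gh p assms(4) by (simp add: composition_rule)
    finally show ?case by (simp add: Suc)
  qed
  then show ?thesis
    using coxeter_gen_relation[of s S t m k] assms(2,3,5,6) one by metis
qed

lemma coxeter_stable_subspace:
  assumes "group_action (coxeter_group S m) V \<rho>" "U \<subseteq> V"
    and "\<And>s u. s \<in> S \<Longrightarrow> u \<in> U \<Longrightarrow> \<rho> (coxeter_gen S m s) u \<in> U"
    and "g \<in> carrier (coxeter_group S m)" "u \<in> U"
  shows "\<rho> g u \<in> U"
proof -
  interpret group_action "coxeter_group S m" V \<rho> by fact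
  have "\<forall>u\<in>U. \<rho> g u \<in> U"
    using assms(4)
  proof (induction rule: coxeter_group_induct)
    case one
    then show ?case using id_eq_one assms(2) by (metis restrict_apply' subsetD)
  next
    case (gen s g)
    then show ?case
      using composition_rule[OF subsetD[OF assms(2)] coxeter_gen_closed[OF gen(1)] gen(2)] assms(3)
      by simp
  qed
  then show ?thesis using assms(5) by blast
qed

text \<open>The stability lemma speaks of arbitrary subsets of \<open>V\<close>, so it applies to
  the singleton of v.\<close>

lemma coxeter_fixed:
  assumes "group_action (coxeter_group S m) V \<rho>" "v \<in> V"
    and "\<And>s. s \<in> S \<Longrightarrow> \<rho> (coxeter_gen S m s) v = v"
    and "g \<in> carrier (coxeter_group S m)"
  shows "\<rho> g v = v"
  using coxeter_stable_subspace[OF assms(1), of "{v}" g v] assms(2-4) by auto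

lemma irreducible_A1_of_rep:
  assumes cox: "irreducible_coxeter_system S m" "simply_laced S m"
    and rep: "A1_representation scale S m V \<rho>" "irreducible_rep scale (coxeter_group S m) V \<rho>"
      "nontrivial_rep (coxeter_group S m) V \<rho>"
  shows "irreducible_A1 scale S (coxeter_edges S m) V (\<lambda>s. \<rho> (coxeter_gen S m s))"
proof -
  let ?G = "coxeter_group S m" and ?\<sigma> = "\<lambda>s. \<rho> (coxeter_gen S m s)"
  have sys: "coxeter_system S m" using cox(1) by (simp add: irreducible_coxeter_system_def)
  note edges = simply_laced_edges[OF sys cox(2)]
  interpret linear_rep scale ?G V \<rho> using rep(2) by (simp add: irreducible_rep_def)
  note act = group_action_axioms
  have sq: "?\<sigma> s (?\<sigma> s v) = v" if "s \<in> S" "v \<in> V" for s v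
    using composition_rule[OF that(2) coxeter_gen_closed[OF that(1)] coxeter_gen_closed[OF that(1)]]
      that(2) id_eq_one by (metis coxeter_gen_square restrict_apply' that(1))
  have cl: "?\<sigma> s v \<in> V" if "s \<in> S" "v \<in> V" for s v
    using element_image[OF coxeter_gen_closed[OF that(1)] that(2)] by simp
  show ?thesis
  proof unfold_locales
    show "finite S" using sys by (simp add: coxeter_system_def)
    show "connected_graph S (coxeter_edges S m)"
      using cox(1) by (simp add: irreducible_coxeter_system_def)
    show "coxeter_edges S m \<subseteq> S \<times> S" "sym (coxeter_edges S m)" "irrefl (coxeter_edges S m)"
      by (rule edges)+
    show "subspace V" by (rule subspace_V)
    fix s assume s: "s \<in> S"
    fix v assume v: "v \<in> V"
    show "?\<sigma> s v \<in> V" "?\<sigma> s (?\<sigma> s v) = v" using s v by (simp_all add: sq cl)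
    show "?\<sigma> s (scale c v) = scale c (?\<sigma> s v)" for c
      using s v by (simp add: rep_scale coxeter_gen_closed)
    show "?\<sigma> s (u + v) = ?\<sigma> s u + ?\<sigma> s v" if "u \<in> V" for u
      using s v that by (simp add: rep_add coxeter_gen_closed)
    fix t assume t: "t \<in> S" "s \<noteq> t"
    show "v = 0" if "?\<sigma> s v = - v" "?\<sigma> t v = - v"
    proof -
      have "m s t < \<infinity>" using edges(4)[of s t] edges(5)[OF s t] by (cases "(s, t) \<in> coxeter_edges S m") auto
      then show ?thesis using rep(1) s t v that unfolding A1_representation_def by blast
    qed
    show "?\<sigma> s (?\<sigma> t v) = ?\<sigma> t (?\<sigma> s v)" if "(s, t) \<notin> coxeter_edges S m"
    proof -
      have "?\<sigma> s (?\<sigma> t (?\<sigma> s (?\<sigma> t w))) = w" if "w \<in> V" for w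
        using coxeter_gen_pow_action[OF act s t(1) that t(2) edges(5)[OF s t \<open>(s, t) \<notin> coxeter_edges S m\<close>]]
        by (simp add: numeral_2_eq_2)
      \<comment> \<open>With w = t s v, the word s t s t t s v collapses to s t v.\<close>
      from this[OF cl[OF t(1) cl[OF s v]]] show ?thesis by (simp add: sq cl s t v)
    qed
  next
    fix s t v assume e: "(s, t) \<in> coxeter_edges S m" and v: "v \<in> V"
    have st: "s \<in> S" "t \<in> S" "s \<noteq> t" using e by (auto simp: coxeter_edges_def)
    have "?\<sigma> s (?\<sigma> t (?\<sigma> s (?\<sigma> t (?\<sigma> s (?\<sigma> t w))))) = w" if "w \<in> V" for w
      using coxeter_gen_pow_action[OF act st(1,2) that st(3) edges(4)[OF e]]
      by (simp add: numeral_3_eq_3)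
    \<comment> \<open>With w = t s t v, the left side collapses to s t s v.\<close>
    from this[OF cl[OF st(2) cl[OF st(1) cl[OF st(2) v]]]]
    show "?\<sigma> s (?\<sigma> t (?\<sigma> s v)) = ?\<sigma> t (?\<sigma> s (?\<sigma> t v))"
      by (simp add: sq cl st v)
  next
    fix U assume U: "subspace U" "U \<subseteq> V" "\<And>s u. s \<in> S \<Longrightarrow> u \<in> U \<Longrightarrow> ?\<sigma> s u \<in> U"
    have "\<forall>g\<in>carrier ?G. \<forall>u\<in>U. \<rho> g u \<in> U"
      using coxeter_stable_subspace[OF act U(2,3)] by blast
    then show "U = {0} \<or> U = V" using rep(2) U unfolding irreducible_rep_def by blast
  next
    show "\<exists>s\<in>S. \<exists>v\<in>V. ?\<sigma> s v \<noteq> v"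
      using coxeter_fixed[OF act] rep(3) unfolding nontrivial_rep_def by blast
  qed
qed

lemma A1_rep_is_R_representation:
  assumes cox: "irreducible_coxeter_system S m" "simply_laced S m"
    and H1: "free_abelian_of_rank (graph_H1 S (coxeter_edges S m)) 0 \<or>
      free_abelian_of_rank (graph_H1 S (coxeter_edges S m)) 1"
    and rep: "A1_representation scale S m V \<rho>" "irreducible_rep scale (coxeter_group S m) V \<rho>"
      "nontrivial_rep (coxeter_group S m) V \<rho>"
  shows "R_representation scale S m V \<rho> \<and> finite_dim scale V"
proof -
  let ?E = "coxeter_edges S m"
  interpret irreducible_A1 scale S ?E V "\<lambda>s. \<rho> (coxeter_gen S m s)"
    by (rule irreducible_A1_of_rep[OF cox rep])
  obtain s0 par d where tree: "spanning_tree S ?E s0 par d"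
    using spanning_tree_exists[OF conn E_sub E_symm E_irr] .
  interpret T: spanning_tree S ?E s0 par d by (rule tree)
  \<comment> \<open>One exceptional pair serves both ranks; if all edges lie in the tree, any pair
    will do.\<close>
  have "\<exists>a b. \<forall>s t. (s, t) \<in> ?E \<longrightarrow> T.tree_edge s t \<or> (s, t) = (a, b) \<or> (s, t) = (b, a)"
    using H1
  proof
    assume "free_abelian_of_rank (graph_H1 S ?E) 0"
    then show ?thesis using T.H1_rank_0_tree by blast
  next
    assume r: "free_abelian_of_rank (graph_H1 S ?E) 1"
    show ?thesis
    proof (cases "\<exists>a b. (a, b) \<in> ?E \<and> \<not> T.tree_edge a b")
      case True
      then obtain a b where "(a, b) \<in> ?E" "\<not> T.tree_edge a b" by blast
      then show ?thesis using T.H1_rank_1_unicyclic[OF r] by blast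
    qed blast
  qed
  then obtain a b where cyc: "\<And>s t. (s, t) \<in> ?E \<Longrightarrow> T.tree_edge s t \<or> (s, t) = (a, b) \<or> (s, t) = (b, a)"
    by blast
  obtain \<alpha> where \<alpha>: "\<And>s. s \<in> S \<Longrightarrow> \<alpha> s \<in> neg_space s" "\<And>s. s \<in> S \<Longrightarrow> \<alpha> s \<noteq> 0"
    and sp: "span (\<alpha> ` S) = V" "\<And>s v. s \<in> S \<Longrightarrow> v \<in> V \<Longrightarrow> refl_diff s v \<in> span {\<alpha> s}"
    by (rule root_vectors_exist[OF tree cyc]) blast+
  have "linear_rep scale (coxeter_group S m) V \<rho>"
    using rep(1) by (simp add: A1_representation_def)
  moreover have "\<exists>H. codim1_subspace scale V H \<and> (\<forall>v\<in>H. \<rho> (coxeter_gen S m s) v = v)" if "s \<in> S" for s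
    using fixed_hyperplane[OF that \<alpha>(1)[OF that] \<alpha>(2)[OF that] sp(2)[OF that]] by blast
  moreover have "\<rho> (coxeter_gen S m s) (\<alpha> s) = - \<alpha> s \<and> \<alpha> s \<in> V" if "s \<in> S" for s
    using \<alpha>(1)[OF that] by (simp add: neg_space_def)
  moreover have "\<alpha> r \<noteq> \<alpha> t \<and> independent {\<alpha> r, \<alpha> t}" if "r \<in> S" "t \<in> S" "r \<noteq> t" for r t
    using root_vectors_independent[OF that \<alpha>(1)[OF that(1)] \<alpha>(1)[OF that(2)]] \<alpha>(2) that by blast
  ultimately have "R_representation scale S m V \<rho>"
    unfolding R_representation_def using \<alpha>(2) sp(1) by (intro conjI exI[of _ \<alpha>]) simp_all
  moreover have "finite_dim scale V"
    unfolding finite_dim_def using fin sp(1) by blast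
  ultimately show ?thesis by blast
qed

text \<open>Both families of root vectors are built over one tree. The Cartan matrix then dictates
  the relations as well as the action, so \<open>\<alpha> s \<mapsto> \<beta> s\<close> extends to
  an equivariant isomorphism.\<close>

lemma A1_rep_unique:
  assumes cox: "irreducible_coxeter_system S m" "simply_laced S m"
    and H1: "free_abelian_of_rank (graph_H1 S (coxeter_edges S m)) 0"
    and rep: "A1_representation scale S m V \<rho>" "irreducible_rep scale (coxeter_group S m) V \<rho>"
      "nontrivial_rep (coxeter_group S m) V \<rho>"
    and rep': "A1_representation scale' S m V' \<rho>'" "irreducible_rep scale' (coxeter_group S m) V' \<rho>'"
      "nontrivial_rep (coxeter_group S m) V' \<rho>'"
  shows "isomorphic_reps (coxeter_group S m) scale V \<rho> scale' V' \<rho>'"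
proof -
  let ?E = "coxeter_edges S m" and ?G = "coxeter_group S m"
  interpret v: irreducible_A1 scale S ?E V "\<lambda>s. \<rho> (coxeter_gen S m s)"
    by (rule irreducible_A1_of_rep[OF cox rep])
  interpret w: irreducible_A1 scale' S ?E V' "\<lambda>s. \<rho>' (coxeter_gen S m s)"
    by (rule irreducible_A1_of_rep[OF cox rep'])
  obtain s0 par d where tree: "spanning_tree S ?E s0 par d"
    using spanning_tree_exists[OF v.conn v.E_sub v.E_symm v.E_irr] .
  interpret T: spanning_tree S ?E s0 par d by (rule tree)
  have te: "T.tree_edge s t" if "(s, t) \<in> ?E" for s t
    using T.H1_rank_0_tree[OF H1 that] .
  obtain \<alpha> where \<alpha>: "\<And>s. s \<in> S \<Longrightarrow> \<alpha> s \<in> v.neg_space s" "\<And>s. s \<in> S \<Longrightarrow> \<alpha> s \<noteq> 0"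
    and \<alpha>_par: "\<And>s. s \<in> S \<Longrightarrow> s \<noteq> s0 \<Longrightarrow> \<alpha> s = v.refl_diff s (\<alpha> (par s))"
    and sp: "v.span (\<alpha> ` S) = V" "\<And>s x. s \<in> S \<Longrightarrow> x \<in> V \<Longrightarrow> v.refl_diff s x \<in> v.span {\<alpha> s}"
    by (rule v.root_vectors_exist[OF tree]) (use te in blast)+
  obtain \<beta> where \<beta>: "\<And>s. s \<in> S \<Longrightarrow> \<beta> s \<in> w.neg_space s" "\<And>s. s \<in> S \<Longrightarrow> \<beta> s \<noteq> 0"
    and \<beta>_par: "\<And>s. s \<in> S \<Longrightarrow> s \<noteq> s0 \<Longrightarrow> \<beta> s = w.refl_diff s (\<beta> (par s))"
    and sp': "w.span (\<beta> ` S) = V'" "\<And>s x. s \<in> S \<Longrightarrow> x \<in> V' \<Longrightarrow> w.refl_diff s x \<in> w.span {\<beta> s}"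
    by (rule w.root_vectors_exist[OF tree]) (use te in blast)+
  \<comment> \<open>Away from the root this is the recursion \<open>\<alpha>_par\<close>; towards
    the root, \<open>refl_diff_edge\<close> inverts that step.\<close>
  have \<alpha>_edge: "v.refl_diff t (\<alpha> s) = \<alpha> t" if e: "(s, t) \<in> ?E" for s t
    using te[OF e] unfolding T.tree_edge_def
  proof (elim disjE conjE)
    assume s: "s \<in> S" "s \<noteq> s0" "t = par s"
    have "(t, s) \<in> ?E" using e v.edge_in_S by blast
    then show ?thesis
      using \<alpha>_par[OF s(1,2)] s(3) v.refl_diff_edge[of t s "\<alpha> t"] \<alpha>(1)[of t] v.edge_in_S[OF e] by simp
  qed (use \<alpha>_par in simp)
  have \<beta>_edge: "w.refl_diff t (\<beta> s) = \<beta> t" if e: "(s, t) \<in> ?E" for s t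
    using te[OF e] unfolding T.tree_edge_def
  proof (elim disjE conjE)
    assume s: "s \<in> S" "s \<noteq> s0" "t = par s"
    have "(t, s) \<in> ?E" using e w.edge_in_S by blast
    then show ?thesis
      using \<beta>_par[OF s(1,2)] s(3) w.refl_diff_edge[of t s "\<beta> t"] \<beta>(1)[of t] w.edge_in_S[OF e] by simp
  qed (use \<beta>_par in simp)
  have rel: "(\<Sum>s\<in>S. scale (c s) (\<alpha> s)) = 0 \<longleftrightarrow> (\<Sum>s\<in>S. scale' (c s) (\<beta> s)) = 0" for c
    using v.root_sum_eq_0_iff[of \<alpha> c] w.root_sum_eq_0_iff[of \<beta> c] \<alpha> \<beta> \<alpha>_edge \<beta>_edge by simp
  obtain f where bij: "bij_betw f V V'"
    and add: "\<And>x y. x \<in> V \<Longrightarrow> y \<in> V \<Longrightarrow> f (x + y) = f x + f y"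
    and sc: "\<And>c x. x \<in> V \<Longrightarrow> f (scale c x) = scale' c (f x)"
    and root: "\<And>s. s \<in> S \<Longrightarrow> f (\<alpha> s) = \<beta> s"
    by (rule linear_iso_of_same_relations[OF v.vector_space_axioms w.vector_space_axioms v.fin sp(1) sp'(1) rel]) blast
  have gen: "f (\<rho> (coxeter_gen S m t) x) = \<rho>' (coxeter_gen S m t) (f x)" if t: "t \<in> S" and x: "x \<in> V" for t x
  proof -
    obtain c where c: "x = (\<Sum>s\<in>S. scale (c s) (\<alpha> s))"
      using x sp(1) v.span_finite_family[OF v.fin, of \<alpha>] by blast
    have aV: "\<alpha> s \<in> V" if "s \<in> S" for s using \<alpha>(1)[OF that] by (rule v.neg_space_sub)
    have "(\<Sum>s\<in>A. scale (c s) (\<alpha> s)) \<in> V \<and>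
        f (\<Sum>s\<in>A. scale (c s) (\<alpha> s)) = (\<Sum>s\<in>A. scale' (c s) (\<beta> s))" if "finite A" "A \<subseteq> S" for A
      using that
    proof (induction A rule: finite_induct)
      case empty
      then show ?case using sc[of 0 0] by simp
    next
      case (insert s A)
      then show ?case by (simp add: add sc root aV)
    qed
    then have fx: "f x = (\<Sum>s\<in>S. scale' (c s) (\<beta> s))" using v.fin c by simp
    \<comment> \<open>The same scalar on both sides, as it depends only on the coefficients and the
      graph.\<close>
    let ?k = "\<Sum>s\<in>S. - c s * root_pairing ?E s t"
    have "v.refl_diff t x = scale ?k (\<alpha> t)"
      unfolding c using \<alpha> \<alpha>_edge t by (intro v.refl_diff_root_sum) auto
    moreover have "w.refl_diff t (f x) = scale' ?k (\<beta> t)"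
      unfolding fx using \<beta> \<beta>_edge t by (intro w.refl_diff_root_sum) auto
    ultimately have "\<rho> (coxeter_gen S m t) x = x + scale ?k (\<alpha> t)"
      "\<rho>' (coxeter_gen S m t) (f x) = f x + scale' ?k (\<beta> t)"
      by (simp_all add: v.refl_diff_def w.refl_diff_def algebra_simps)
    then show ?thesis using t x aV by (simp add: add sc root)
  qed
  interpret v: linear_rep scale ?G V \<rho> using rep(2) by (simp add: irreducible_rep_def)
  interpret w: linear_rep scale' ?G V' \<rho>' using rep'(2) by (simp add: irreducible_rep_def)
  have fV: "f x \<in> V'" if "x \<in> V" for x using bij that by (auto simp: bij_betw_def)
  have "\<forall>x\<in>V. f (\<rho> g x) = \<rho>' g (f x)" if "g \<in> carrier ?G" for g
    using that
  proof (induction rule: coxeter_group_induct)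
    case one
    then show ?case using v.id_eq_one w.id_eq_one fV by (metis restrict_apply')
  next
    case (gen s g)
    have "\<rho> g x \<in> V" if "x \<in> V" for x using v.element_image[OF gen(2) that] by simp
    then show ?case
      using gen(3) gen(1) by (simp add: v.composition_rule w.composition_rule coxeter_gen_closed gen(2) fV
          \<open>\<And>x t. t \<in> S \<Longrightarrow> x \<in> V \<Longrightarrow> f (\<rho> (coxeter_gen S m t) x) = \<rho>' (coxeter_gen S m t) (f x)\<close>)
  qed
  then show ?thesis
    unfolding isomorphic_reps_def using bij add sc by blast
qed

section \<open>The dual reflection representation\<close>

definition pm_scale :: "complex \<Rightarrow> ('s \<Rightarrow>\<^sub>0 complex) \<Rightarrow> ('s \<Rightarrow>\<^sub>0 complex)" where
  "pm_scale c p = Poly_Mapping.map (\<lambda>x. c * x) p"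

lemma lookup_pm_scale [simp]: "Poly_Mapping.lookup (pm_scale c p) k = c * Poly_Mapping.lookup p k"
  by (simp add: pm_scale_def Poly_Mapping.map.rep_eq when_def)

lemma vector_space_pm_scale: "vector_space pm_scale"
  by unfold_locales (auto intro!: poly_mapping_eqI simp: lookup_add algebra_simps)

text \<open>The geometric representation modulo its radical is realised without quotients, as the span
  of the rows of the Cartan matrix inside the dual of the geometric representation.\<close>

definition cartan_row :: "'s set \<Rightarrow> ('s \<times> 's) set \<Rightarrow> 's \<Rightarrow> 's \<Rightarrow>\<^sub>0 complex" where
  "cartan_row S E s = Abs_poly_mapping (\<lambda>t. root_pairing E s t when t \<in> S)"

lemma lookup_cartan_row:
  assumes "finite S"
  shows "Poly_Mapping.lookup (cartan_row S E s) t = (root_pairing E s t when t \<in> S)"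
proof -
  have "finite {t. (root_pairing E s t when t \<in> S) \<noteq> 0}"
    by (rule finite_subset[OF _ assms]) (auto simp: when_def)
  then show ?thesis by (simp add: cartan_row_def)
qed

text \<open>Read \<open>lookup x s\<close> as the value of the functional x at the simple root of s.
  Then this is the contragredient of the geometric reflection, x going to x - x(s) B(s, -).\<close>

definition dual_reflection :: "'s set \<Rightarrow> ('s \<times> 's) set \<Rightarrow> 's \<Rightarrow> ('s \<Rightarrow>\<^sub>0 complex) \<Rightarrow> ('s \<Rightarrow>\<^sub>0 complex)" where
  "dual_reflection S E s x = x - pm_scale (Poly_Mapping.lookup x s) (cartan_row S E s)"

text \<open>Here x - s x is the coordinate x(s) times the row of s. A nonzero coordinate in a
  subrepresentation thus produces a row, connectedness produces all rows, and a vector without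
  nonzero coordinates is 0, so no radical is left to divide out.\<close>

lemma A1_rep_exists:
  fixes S :: "'s set"
  assumes cox: "irreducible_coxeter_system S m" "simply_laced S m"
  shows "\<exists>(scale :: complex \<Rightarrow> ('s \<Rightarrow>\<^sub>0 complex) \<Rightarrow> ('s \<Rightarrow>\<^sub>0 complex)) V \<rho>.
    A1_representation scale S m V \<rho> \<and>
    irreducible_rep scale (coxeter_group S m) V \<rho> \<and>
    nontrivial_rep (coxeter_group S m) V \<rho>"
proof -
  let ?E = "coxeter_edges S m" and ?G = "coxeter_group S m"
  have sys: "coxeter_system S m" and conn: "connected_graph S ?E"
    using cox(1) by (simp_all add: irreducible_coxeter_system_def)
  have fin: "finite S" using sys by (simp add: coxeter_system_def)
  note edges = simply_laced_edges[OF sys cox(2)]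
  interpret P: vector_space "pm_scale :: complex \<Rightarrow> ('s \<Rightarrow>\<^sub>0 complex) \<Rightarrow> ('s \<Rightarrow>\<^sub>0 complex)"
    by (rule vector_space_pm_scale)
  let ?a = "cartan_row S ?E" and ?r = "dual_reflection S ?E"
  note row = lookup_cartan_row[OF fin]
  define V where "V = P.span (?a ` S)"
  have subV: "P.subspace V" by (simp add: V_def)
  have aV: "?a s \<in> V" if "s \<in> S" for s using that by (simp add: V_def P.span_base)
  have self: "Poly_Mapping.lookup (?a s) s = 2" if "s \<in> S" for s
    using that by (simp add: row root_pairing_def)
  have edge: "Poly_Mapping.lookup (?a s) t = -1" if "(s, t) \<in> ?E" for s t
    using that edges(1,3) by (auto simp: row root_pairing_def irrefl_def)
  have nonedge: "Poly_Mapping.lookup (?a s) t = 0" if "s \<noteq> t" "(s, t) \<notin> ?E" for s t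
    using that by (simp add: row root_pairing_def when_def)
  have lk: "Poly_Mapping.lookup (?r s x) u = Poly_Mapping.lookup x u
      - Poly_Mapping.lookup x s * Poly_Mapping.lookup (?a s) u" for s x u
    by (simp add: dual_reflection_def lookup_minus)
  have symE: "(t, s) \<in> ?E" if "(s, t) \<in> ?E" for s t using edges(2) that by (rule symD)
  have closed: "?r s x \<in> V" if "s \<in> S" "x \<in> V" for s x
    using that aV subV by (simp add: dual_reflection_def P.subspace_diff P.subspace_scale)
  have square: "?r s (?r s x) = x" if "s \<in> S" for s x
    by (rule poly_mapping_eqI) (simp add: lk self that algebra_simps)
  \<comment> \<open>Checked coordinatewise: the entries 2, -1 and 0 turn each relation into a
    polynomial identity, valid for all x.\<close>
  have relation: "((\<lambda>y. ?r s (?r t y)) ^^ k) x = x"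
    if st: "s \<in> S" "t \<in> S" "s \<noteq> t" "m s t = enat k" for s t k x
  proof (cases "(s, t) \<in> ?E")
    case True
    then have k: "k = 3" using edges(4)[OF True] st(4) by simp
    show ?thesis unfolding k
      by (rule poly_mapping_eqI)
        (simp add: numeral_3_eq_3 lk self st edge[OF True] edge[OF symE[OF True]] algebra_simps)
  next
    case False
    then have k: "k = 2" using edges(5)[OF st(1-3) False] st(4) by simp
    have ts: "(t, s) \<notin> ?E" using False symE by blast
    show ?thesis unfolding k
      by (rule poly_mapping_eqI)
        (simp add: numeral_2_eq_2 lk self st nonedge[OF st(3) False] nonedge[OF st(3)[symmetric] ts]
          algebra_simps)
  qed
  obtain \<rho> where act: "group_action ?G V \<rho>"
    and gen: "\<And>s x. s \<in> S \<Longrightarrow> x \<in> V \<Longrightarrow> \<rho> (coxeter_gen S m s) x = ?r s x"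
    by (rule coxeter_action_exists[of S V ?r m, OF closed square relation]) blast+
  interpret group_action ?G V \<rho> by (rule act)
  have \<rho>V: "\<rho> g x \<in> V" if "g \<in> carrier ?G" "x \<in> V" for g x
    using element_image[OF that] by simp
  have one: "\<rho> \<one>\<^bsub>?G\<^esub> x = x" if "x \<in> V" for x
    using id_eq_one that by (metis restrict_apply')
  have add: "\<rho> g (x + y) = \<rho> g x + \<rho> g y" if "g \<in> carrier ?G" "x \<in> V" "y \<in> V" for g x y
    using that
  proof (induction rule: coxeter_group_induct)
    case one
    then show ?case using subV by (simp add: \<open>\<And>x. x \<in> V \<Longrightarrow> \<rho> \<one>\<^bsub>?G\<^esub> x = x\<close> P.subspace_add)
  next
    case (gen s g)
    then show ?case
      using subV by (simp add: composition_rule coxeter_gen_closed P.subspace_add \<rho>V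
          \<open>\<And>s x. s \<in> S \<Longrightarrow> x \<in> V \<Longrightarrow> \<rho> (coxeter_gen S m s) x = ?r s x\<close>)
        (auto intro!: poly_mapping_eqI simp: lk lookup_add algebra_simps)
  qed
  have scale: "\<rho> g (pm_scale c x) = pm_scale c (\<rho> g x)" if "g \<in> carrier ?G" "x \<in> V" for g c x
    using that
  proof (induction rule: coxeter_group_induct)
    case one
    then show ?case using subV by (simp add: \<open>\<And>x. x \<in> V \<Longrightarrow> \<rho> \<one>\<^bsub>?G\<^esub> x = x\<close> P.subspace_scale)
  next
    case (gen s g)
    then show ?case
      using subV by (simp add: composition_rule coxeter_gen_closed P.subspace_scale \<rho>V
          \<open>\<And>s x. s \<in> S \<Longrightarrow> x \<in> V \<Longrightarrow> \<rho> (coxeter_gen S m s) x = ?r s x\<close>)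
        (auto intro!: poly_mapping_eqI simp: lk algebra_simps)
  qed
  have rep: "linear_rep pm_scale ?G V \<rho>"
    using P.vector_space_axioms act
    by (intro linear_rep.intro linear_rep_axioms.intro) (simp_all add: subV add scale)
  \<comment> \<open>A -1-eigenvector of s is the row of s times half its own coordinate at
    s.\<close>
  have neg: "pm_scale 2 x = pm_scale (Poly_Mapping.lookup x s) (?a s)"
    if "s \<in> S" "x \<in> V" "\<rho> (coxeter_gen S m s) x = - x" for s x
  proof (rule poly_mapping_eqI)
    fix u
    have "Poly_Mapping.lookup (?r s x) u = - Poly_Mapping.lookup x u"
      using that gen[OF that(1,2)] by simp
    then show "Poly_Mapping.lookup (pm_scale 2 x) u
        = Poly_Mapping.lookup (pm_scale (Poly_Mapping.lookup x s) (?a s)) u"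
      by (simp add: lk algebra_simps)
  qed
  have "A1_representation pm_scale S m V \<rho>"
    unfolding A1_representation_def
  proof (intro conjI rep notI; elim bexE conjE)
    fix x r t
    assume x: "x \<in> V - {0}" and rt: "r \<in> S" "t \<in> S" "r \<noteq> t"
      and "\<rho> (coxeter_gen S m r) x = - x" "\<rho> (coxeter_gen S m t) x = - x"
    then have 2: "2 * Poly_Mapping.lookup x u = Poly_Mapping.lookup x r * Poly_Mapping.lookup (?a r) u"
      "2 * Poly_Mapping.lookup x u = Poly_Mapping.lookup x t * Poly_Mapping.lookup (?a t) u" for u
      using neg[of r x] neg[of t x] by (metis DiffD1 lookup_pm_scale)+
    have "Poly_Mapping.lookup x r = 0"
    proof (cases "(r, t) \<in> ?E")
      case True
      have "2 * Poly_Mapping.lookup x t = - Poly_Mapping.lookup x r"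
        "2 * Poly_Mapping.lookup x r = - Poly_Mapping.lookup x t"
        using 2(1)[of t] 2(2)[of r] edge[OF True] edge[OF symE[OF True]] by simp_all
      \<comment> \<open>Eliminating the coordinate at t gives 4 x(r) = x(r).\<close>
      then have "3 * Poly_Mapping.lookup x r = 0" by algebra
      then show ?thesis by simp
    next
      case False
      then have "(t, r) \<notin> ?E" using symE by blast
      then show ?thesis using 2(2)[of r] nonedge[of t r] rt(3) by simp
    qed
    then have "x = 0" using 2(1) by (intro poly_mapping_eqI) simp
    then show False using x by simp
  qed
  moreover have "irreducible_rep pm_scale ?G V \<rho>"
    unfolding irreducible_rep_def
  proof (intro conjI rep allI impI)
    obtain s where s: "s \<in> S" using conn by (auto simp: connected_graph_def)
    have "?a s \<noteq> 0" using self[OF s] by auto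
    then show "V \<noteq> {0}" using aV[OF s] by blast
    fix U assume U: "P.subspace U \<and> U \<subseteq> V \<and> (\<forall>g\<in>carrier ?G. \<forall>u\<in>U. \<rho> g u \<in> U)"
    show "U = {0} \<or> U = V"
    proof (rule disjCI)
      assume "U \<noteq> V"
      have row_in: "?a s \<in> U" if s: "s \<in> S" and x: "x \<in> U" "Poly_Mapping.lookup x s \<noteq> 0" for s x
      proof -
        have "x \<in> V" using U x(1) by blast
        then have "?r s x \<in> U"
          using U x(1) gen[OF s, of x] coxeter_gen_closed[OF s, of m] by metis
        then have "x - ?r s x \<in> U" using U x(1) by (simp add: P.subspace_diff)
        then have "pm_scale (inverse (Poly_Mapping.lookup x s)) (x - ?r s x) \<in> U"
          using U by (simp add: P.subspace_scale)
        moreover have "pm_scale (inverse (Poly_Mapping.lookup x s)) (x - ?r s x) = ?a s"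
          using x(2) by (simp add: dual_reflection_def)
        ultimately show ?thesis by simp
      qed
      have "Poly_Mapping.lookup x s = 0" if x: "x \<in> U" and s: "s \<in> S" for x s
      proof (rule ccontr)
        assume "Poly_Mapping.lookup x s \<noteq> 0"
        then have s0: "?a s \<in> U" using row_in s x by blast
        have "?a t \<in> U" if "t \<in> S" for t
        proof -
          have "(s, t) \<in> ?E\<^sup>*" using conn s that by (simp add: connected_graph_def)
          then show ?thesis
          proof induction
            case (step y z)
            then show ?case using row_in[of z "?a y"] edge[OF step(2)] edges(1) by auto
          qed (rule s0)
        qed
        then have "V \<subseteq> U" unfolding V_def using U by (intro P.span_minimal) auto
        then show False using U \<open>U \<noteq> V\<close> by blast
      qed
      \<comment> \<open>The type \<open>'s\<close> may be larger than \<open>S\<close>; the rows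
        vanish outside \<open>S\<close>, hence so does every vector of \<open>V\<close>.\<close>
      moreover have "Poly_Mapping.lookup x u = 0" if "x \<in> V" "u \<notin> S" for x u
      proof -
        have "P.subspace {x. Poly_Mapping.lookup x u = 0}"
          by (intro P.subspaceI) (auto simp: lookup_add)
        moreover have "?a ` S \<subseteq> {x. Poly_Mapping.lookup x u = 0}"
          using that(2) by (auto simp: row)
        ultimately have "V \<subseteq> {x. Poly_Mapping.lookup x u = 0}"
          unfolding V_def by (intro P.span_minimal)
        then show ?thesis using that(1) by blast
      qed
      ultimately have "x = 0" if "x \<in> U" for x
        using U that by (intro poly_mapping_eqI) (metis lookup_zero subsetD)
      then show "U = {0}" using U P.subspace_0 by blast
    qed
  qed
  moreover have "nontrivial_rep ?G V \<rho>"
  proof -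
    obtain s where s: "s \<in> S" using conn by (auto simp: connected_graph_def)
    have "Poly_Mapping.lookup (\<rho> (coxeter_gen S m s) (?a s)) s \<noteq> Poly_Mapping.lookup (?a s) s"
      using gen[OF s aV[OF s]] by (simp add: lk self s)
    then have "\<rho> (coxeter_gen S m s) (?a s) \<noteq> ?a s" by metis
    then show ?thesis
      unfolding nontrivial_rep_def using aV[OF s] coxeter_gen_closed[OF s] by blast
  qed
  ultimately show ?thesis by blast
qed

text \<open>Existence names a concrete ambient type, since an arbitrary \<open>'v\<close> may be too
  small to hold such a representation; uniqueness compares spaces inside two unrelated
  types.\<close>

theorem theorem8p3:
  fixes S :: "'s set" and m :: "'s \<Rightarrow> 's \<Rightarrow> enat"
  assumes "irreducible_coxeter_system S m"
    and "simply_laced S m"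
    and "free_abelian_of_rank (graph_H1 S (coxeter_edges S m)) 0 \<or>
      free_abelian_of_rank (graph_H1 S (coxeter_edges S m)) 1"
  shows
    "(\<forall>(scale :: complex \<Rightarrow> 'v \<Rightarrow> 'v::ab_group_add) V \<rho>.
        A1_representation scale S m V \<rho> \<and>
        irreducible_rep scale (coxeter_group S m) V \<rho> \<and>
        nontrivial_rep (coxeter_group S m) V \<rho>
        \<longrightarrow> R_representation scale S m V \<rho> \<and> finite_dim scale V) \<and>
     (free_abelian_of_rank (graph_H1 S (coxeter_edges S m)) 0 \<longrightarrow>
       (\<exists>(scale :: complex \<Rightarrow> ('s \<Rightarrow>\<^sub>0 complex) \<Rightarrow> ('s \<Rightarrow>\<^sub>0 complex)) V \<rho>.
         A1_representation scale S m V \<rho> \<and>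
         irreducible_rep scale (coxeter_group S m) V \<rho> \<and>
         nontrivial_rep (coxeter_group S m) V \<rho>) \<and>
       (\<forall>(scale :: complex \<Rightarrow> 'v \<Rightarrow> 'v) V \<rho>
          (scale' :: complex \<Rightarrow> 'w \<Rightarrow> 'w::ab_group_add) V' \<rho>'.
         A1_representation scale S m V \<rho> \<and>
         irreducible_rep scale (coxeter_group S m) V \<rho> \<and>
         nontrivial_rep (coxeter_group S m) V \<rho> \<and>
         A1_representation scale' S m V' \<rho>' \<and>
         irreducible_rep scale' (coxeter_group S m) V' \<rho>' \<and>
         nontrivial_rep (coxeter_group S m) V' \<rho>'
         \<longrightarrow> isomorphic_reps (coxeter_group S m) scale V \<rho> scale' V' \<rho>'))"
proof (intro conjI impI allI)
  fix scale :: "complex \<Rightarrow> 'v \<Rightarrow> 'v" and V \<rho>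
  assume "A1_representation scale S m V \<rho> \<and> irreducible_rep scale (coxeter_group S m) V \<rho> \<and>
    nontrivial_rep (coxeter_group S m) V \<rho>"
  then show "R_representation scale S m V \<rho>" "finite_dim scale V"
    using A1_rep_is_R_representation[OF assms] by blast+
next
  show "\<exists>(scale :: complex \<Rightarrow> ('s \<Rightarrow>\<^sub>0 complex) \<Rightarrow> ('s \<Rightarrow>\<^sub>0 complex)) V \<rho>.
      A1_representation scale S m V \<rho> \<and>
      irreducible_rep scale (coxeter_group S m) V \<rho> \<and>
      nontrivial_rep (coxeter_group S m) V \<rho>"
    by (rule A1_rep_exists[OF assms(1,2)])
next
  fix scale :: "complex \<Rightarrow> 'v \<Rightarrow> 'v" and V \<rho> and scale' :: "complex \<Rightarrow> 'w \<Rightarrow> 'w" and V' \<rho>'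
  assume "free_abelian_of_rank (graph_H1 S (coxeter_edges S m)) 0"
    and "A1_representation scale S m V \<rho> \<and> irreducible_rep scale (coxeter_group S m) V \<rho> \<and>
      nontrivial_rep (coxeter_group S m) V \<rho> \<and>
      A1_representation scale' S m V' \<rho>' \<and> irreducible_rep scale' (coxeter_group S m) V' \<rho>' \<and>
      nontrivial_rep (coxeter_group S m) V' \<rho>'"
  then show "isomorphic_reps (coxeter_group S m) scale V \<rho> scale' V' \<rho>'"
    using A1_rep_unique[OF assms(1,2)] by blast
qed

end
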